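(* Let $n\ge 1$ be an integer. For every subset $M\subseteq[0,n-1]$, $$\sum_{\{\sigma\in B_n\,|\,\mathrm{Des}_B(\sigma^{-1})=M\}} q^{\ell_B(\sigma)}=\sum_{\{\sigma\in B_n\,|\,\mathrm{Des}_B(\sigma^{-1})=M\}} q^{\mathrm{fmaj}(\sigma)}.$$
   Context: Here $q$ is an indeterminate, $[0,n-1]=\{0,1,\ldots,n-1\}$ and $[\pm n]=\{-n,\ldots,-1,1,\ldots,n\}$. $B_n$ is the hyperoctahedral group: the group (under composition) of all bijections $\sigma$ of $[\pm n]$ with $\sigma(-a)=-\sigma(a)$ for all $a\in[\pm n]$. Write $\sigma=[\sigma(1),\ldots,\sigma(n)]$. $B_n$ is a Coxeter group with generators $s_0=[-1,2,\ldots,n]$ and $s_i=[1,\ldots,i-1,i+1,i,i+2,\ldots,n]$ for $1\le i<n$; $\ell_B(\sigma)$ is the length of $\sigma$, i.e. the minimal $r\in\{0,1,2,\ldots\}$ such that $\sigma=s_{i_1}\cdots s_{i_r}$ for some $i_1,\ldots,i_r\in[0,n-1]$. The $B$-descent set is $\mathrm{Des}_B(\sigma)=\{i\in[0,n-1] : \ell_B(\sigma s_i)<\ell_B(\sigma)\}$ (equivalently, $\{i\in[0,n-1]:\sigma(i)>\sigma(i+1)\}$ with $\sigma(0):=0$). The flag major index is $\mathrm{fmaj}(\sigma)=2\cdot\mathrm{maj}_A(\sigma)+\mathrm{neg}(\sigma)$, where $\mathrm{maj}_A(\sigma)=\sum_{\{1\le i\le n-1\,:\,\sigma(i)>\sigma(i+1)\}}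 i$ (with the usual order $-n<\cdots<-1<1<\cdots<n$) and $\mathrm{neg}(\sigma)=|\{i\in\{1,\ldots,n\}:\sigma(i)<0\}|$. *)

theory Defs
  imports
    "HOL-Combinatorics.Permutations"
    "HOL-Computational_Algebra.Polynomial"
begin

definition pm_set :: "nat \<Rightarrow> int set" where
  "pm_set n = {- int n..int n} - {0}"

text \<open>
  A bijection of \<open>pm_set n\<close> is represented by its extension to all integers by the identity,
  so composition and inversion are the ordinary \<open>\<circ>\<close> and \<open>inv\<close>.
  In particular every element of \<open>hyperoct n\<close> maps \<open>0\<close> to \<open>0\<close>.
\<close>

definition hyperoct :: "nat \<Rightarrow> (int \<Rightarrow> int) set" where
  "hyperoct n = {\<sigma>. \<sigma> permutes pm_set n \<and> (\<forall>a\<in>pm_set n. \<sigma> (- a) = - \<sigma> a)}"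

definition gen_B :: "nat \<Rightarrow> int \<Rightarrow> int" where
  "gen_B i = (if i = 0 then transpose 1 (- 1)
     else transpose (int i) (int i + 1) \<circ> transpose (- int i) (- (int i + 1)))"

definition word_B :: "nat list \<Rightarrow> int \<Rightarrow> int" where
  "word_B is = foldr (\<lambda>i \<tau>. gen_B i \<circ> \<tau>) is id"

definition length_B :: "nat \<Rightarrow> (int \<Rightarrow> int) \<Rightarrow> nat" where
  "length_B n \<sigma> = (LEAST r. \<exists>is. length is = r \<and> set is \<subseteq> {0..<n} \<and> \<sigma> = word_B is)"

definition Des_B :: "nat \<Rightarrow> (int \<Rightarrow> int) \<Rightarrow> nat set" where
  "Des_B n \<sigma> = {i \<in> {0..<n}. length_B n (\<sigma> \<circ> gen_B i) < length_B n \<sigma>}"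

definition maj_A :: "nat \<Rightarrow> (int \<Rightarrow> int) \<Rightarrow> nat" where
  "maj_A n \<sigma> = (\<Sum>i | i \<in> {1..<n} \<and> \<sigma> (int i) > \<sigma> (int i + 1). i)"

definition neg_B :: "nat \<Rightarrow> (int \<Rightarrow> int) \<Rightarrow> nat" where
  "neg_B n \<sigma> = card {i \<in> {1..n}. \<sigma> (int i) < 0}"

definition fmaj :: "nat \<Rightarrow> (int \<Rightarrow> int) \<Rightarrow> nat" where
  "fmaj n \<sigma> = 2 * maj_A n \<sigma> + neg_B n \<sigma>"

lemma finite_hyperoct: "finite (hyperoct n)"
proof -
  have "finite {\<sigma>. \<sigma> permutes pm_set n}"
    by (rule finite_permutations) (simp add: pm_set_def)
  then show ?thesis
    by (rule rev_finite_subset) (auto simp: hyperoct_def)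
qed

end

theory Submission
  imports Defs "HOL-Combinatorics.Multiset_Permutations"
begin

text \<open>
  Encode \<open>\<sigma>\<close> by the window \<open>t\<close> of \<open>\<sigma>\<inverse>\<close>; the \<open>B\<close>-length is the same for \<open>\<sigma>\<close> and \<open>\<sigma>\<inverse>\<close>, and the condition
  on \<open>\<sigma>\<inverse>\<close> becomes one on the descents of \<open>0 # t\<close>. As in Foata's second fundamental transformation,
  one proves by induction on \<open>n\<close> the stronger claim that both statistics have the same joint
  distribution with the descents of \<open>0 # t\<close> and the last letter \<open>\<sigma> n\<close>, that is, the signed position
  of \<open>\<plusminus>n\<close> in \<open>t\<close>.

  Removing \<open>\<plusminus>(N + 1)\<close> from \<open>t = A @ [\<plusminus>(N + 1)] @ B\<close> leaves \<open>w = A @ B\<close>. The length drops by a number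
  depending only on the lengths \<open>k\<close>, \<open>l\<close> of \<open>A\<close>, \<open>B\<close> and on the sign, while \<open>fmaj\<close> drops by an amount
  depending also on whether \<open>\<plusminus>N\<close> lies in \<open>B\<close>. The induction hypothesis trades \<open>fmaj\<close> for the length
  on \<open>w\<close>, and it remains to compare two length enumerators over the words \<open>A @ B\<close> with given descents of
  \<open>0 # A\<close> and of \<open>B\<close>. These factor: relabelling monotonically, only a sum \<open>C(k, l)\<close> over \<open>U = set B\<close>
  matters. It obeys a recursion of \<open>q\<close>-Pascal type, and the comparison amounts to
  \<open>(1 - q\<^sup>2\<^sup>k) C(k, l - 1) = (1 - q\<^sup>l) C(k - 1, l)\<close>.
\<close>

section \<open>Length and descents of signed words\<close>

text \<open>
  The \<open>B\<close>-length counts the pairs of positions \<open>i < j\<close> with \<open>x\<^sub>i > x\<^sub>j\<close>, those with \<open>- x\<^sub>i > x\<^sub>j\<close>,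
  and the negative letters. In this form the interaction of two letters does not depend on the
  sign of the first one (\<open>cross_abs\<close>).
\<close>

definition cross :: "int \<Rightarrow> int \<Rightarrow> nat" where
  "cross x y = of_bool (y < x) + of_bool (y < - x)"

fun len :: "int list \<Rightarrow> nat" where
  "len [] = 0"
| "len (x # xs) = of_bool (x < 0) + (\<Sum>y\<leftarrow>xs. cross x y) + len xs"

fun invs :: "'a::linorder list \<Rightarrow> nat" where
  "invs [] = 0"
| "invs (x # xs) = (\<Sum>y\<leftarrow>xs. of_bool (y < x)) + invs xs"

fun neg_pairs :: "int list \<Rightarrow> nat" where
  "neg_pairs [] = 0"
| "neg_pairs (x # xs) = of_bool (x < 0) + (\<Sum>y\<leftarrow>xs. of_bool (y < - x)) + neg_pairs xs"

fun dsc :: "'a::linorder list \<Rightarrow> bool list" where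
  "dsc (x # y # xs) = (x > y) # dsc (y # xs)"
| "dsc xs = []"

lemma length_dsc [simp]: "length (dsc xs) = length xs - 1"
  by (induction xs rule: dsc.induct) auto

lemma dsc_append:
  "dsc (xs @ y # ys) = dsc (xs @ [y]) @ dsc (y # ys)"
  by (induction xs rule: dsc.induct) auto

lemma dsc_snoc: "xs \<noteq> [] \<Longrightarrow> dsc (xs @ [y]) = dsc xs @ [last xs > y]"
  by (induction xs rule: dsc.induct) auto

lemma nth_dsc: "Suc i < length xs \<Longrightarrow> dsc xs ! i \<longleftrightarrow> xs ! i > xs ! Suc i"
proof (induction xs arbitrary: i rule: dsc.induct)
  case (1 x y xs)
  then show ?case by (cases i) auto
qed auto

lemma len_append:
  "len (xs @ ys) = len xs + len ys + (\<Sum>x\<leftarrow>xs. \<Sum>y\<leftarrow>ys. cross x y)"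
  by (induction xs) auto

lemma len_eq_invs_neg_pairs: "len xs = invs xs + neg_pairs xs"
  by (induction xs) (simp_all add: cross_def [abs_def] sum_list_addf)

text \<open>Doubling turns unordered pairs into all ordered pairs, the diagonal absorbing one copy
  of the negative letters. The right-hand side no longer depends on the order of the
  letters.\<close>

lemma double_neg_pairs:
  "2 * neg_pairs xs = (\<Sum>x\<leftarrow>xs. \<Sum>y\<leftarrow>xs. of_bool (x + y < 0)) + (\<Sum>x\<leftarrow>xs. of_bool (x < 0))"
proof (induction xs)
  case (Cons x xs)
  have "of_bool (y < - x) = (of_bool (x + y < 0) :: nat)" "of_bool (y + x < 0) = (of_bool (x + y < 0) :: nat)" for y
    by (auto simp: of_bool_def)
  then show ?case
    using Cons by (simp add: sum_list_addf)
qed simp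

lemma neg_pairs_distinct_cong:
  assumes "distinct xs" "distinct ys" "set xs = set ys"
  shows "neg_pairs xs = neg_pairs ys"
proof -
  have "2 * neg_pairs xs = 2 * neg_pairs ys"
    using assms unfolding double_neg_pairs by (simp add: sum_list_distinct_conv_sum_set)
  then show ?thesis by simp
qed

lemma invs_sorted: "sorted xs \<Longrightarrow> invs xs = 0"
  by (induction xs) (auto simp: sum_list_eq_0_iff)

lemma cross_abs: "cross \<bar>x\<bar> = cross x"
  by (auto simp: cross_def abs_if)

lemma len_pos_sorted: "sorted xs \<Longrightarrow> (\<And>x. x \<in> set xs \<Longrightarrow> 0 < x) \<Longrightarrow> len xs = 0"
  by (induction xs) (fastforce simp: sum_list_eq_0_iff cross_def)+

section \<open>Monotone relabelling of letters\<close>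

lemma strict_mono_on_less_iff:
  fixes f :: "'a::linorder \<Rightarrow> 'b::linorder"
  assumes "strict_mono_on A f" "x \<in> A" "y \<in> A"
  shows "f x < f y \<longleftrightarrow> x < y"
  by (metis assms linorder_less_linear order_less_asym strict_mono_onD order_less_irrefl)

lemma invs_map_strict_mono_on:
  assumes "strict_mono_on A f" "set xs \<subseteq> A"
  shows "invs (map f xs) = invs xs"
  using assms(2)
  by (induction xs)
     (auto simp: strict_mono_on_less_iff[OF assms(1)] comp_def intro!: arg_cong[of _ _ sum_list] map_cong)

lemma dsc_map_strict_mono_on:
  assumes "strict_mono_on A f" "set xs \<subseteq> A"
  shows "dsc (map f xs) = dsc xs"
  using assms(2)
  by (induction xs rule: dsc.induct) (auto simp: strict_mono_on_less_iff[OF assms(1)])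

text \<open>\<open>cross\<close> compares \<open>y\<close> with \<open>- x\<close> as well as with
  \<open>x\<close>, so the relabelling has to be odd on a symmetric domain.\<close>

lemma len_map_strict_mono_on:
  assumes "strict_mono_on A f" "set xs \<subseteq> A" "0 \<in> A" "f 0 = 0"
    and "\<And>x. x \<in> A \<Longrightarrow> - x \<in> A \<and> f (- x) = - f x"
  shows "len (map f xs) = len xs"
  using assms(2)
proof (induction xs)
  case (Cons x xs)
  have "f x < 0 \<longleftrightarrow> x < 0"
    using strict_mono_on_less_iff[OF assms(1), of x 0] assms Cons by auto
  moreover have "cross (f x) (f y) = cross x y" if "y \<in> set xs" for y
    using strict_mono_on_less_iff[OF assms(1), of y x] strict_mono_on_less_iff[OF assms(1), of y "-x"]
      assms(5)[of x] that Cons.prems by (auto simp: cross_def)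
  ultimately show ?case
    using Cons by (auto simp: comp_def intro!: arg_cong[of _ _ sum_list] map_cong)
qed simp

section \<open>Factorization of signed words\<close>

text \<open>By \<open>cross_abs\<close> the interaction of a prefix with a suffix sees only the
  absolute values in the prefix, and a double sum ignores order. This makes the length of
  \<open>A @ B\<close> split.\<close>

lemma cross_sum_distinct_cong:
  assumes "distinct (map abs xs)" "distinct xs'" "abs ` set xs = set xs'"
    and "distinct ys" "distinct ys'" "set ys = set ys'"
  shows "(\<Sum>x\<leftarrow>xs. \<Sum>y\<leftarrow>ys. cross x y) = (\<Sum>x\<leftarrow>xs'. \<Sum>y\<leftarrow>ys'. cross x y)"
proof -
  have "(\<Sum>x\<leftarrow>xs. \<Sum>y\<leftarrow>ys. cross x y) = (\<Sum>x\<leftarrow>map abs xs. \<Sum>y\<leftarrow>ys. cross x y)"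
    by (simp add: comp_def cross_abs)
  also have "\<dots> = (\<Sum>x\<in>abs ` set xs. \<Sum>y\<in>set ys. cross x y)"
    using assms by (simp only: sum_list_distinct_conv_sum_set set_map)
  also have "\<dots> = (\<Sum>x\<leftarrow>xs'. \<Sum>y\<leftarrow>ys'. cross x y)"
    using assms by (simp add: sum_list_distinct_conv_sum_set)
  finally show ?thesis .
qed

text \<open>For \<open>K = {1..int n}\<close> these are the windows of \<open>hyperoct n\<close>
  (\<open>window_bij\<close>); other \<open>K\<close> occur as the absolute values of a
  prefix.\<close>

definition signed_words :: "int set \<Rightarrow> int list set" where
  "signed_words K = {t. map abs t \<in> permutations_of_set K}"

lemma signed_wordsD:
  assumes "t \<in> signed_words K"
  shows "distinct (map abs t)" "abs ` set t = K" "length t = card K" "distinct t"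
proof -
  show *: "distinct (map abs t)" "abs ` set t = K"
    using assms by (auto simp: signed_words_def permutations_of_set_def)
  show "length t = card K" "distinct t"
    using distinct_card[OF *(1)] * by (auto simp: distinct_map)
qed

lemma finite_signed_words: "finite (signed_words K)"
proof (cases "finite K")
  case True
  have "signed_words K \<subseteq> {t. set t \<subseteq> K \<union> uminus ` K \<and> length t = card K}"
  proof clarify
    fix t assume t: "t \<in> signed_words K"
    have "x \<in> K \<union> uminus ` K" if "x \<in> set t" for x
    proof -
      have "\<bar>x\<bar> \<in> K" using signed_wordsD(2)[OF t] that by blast
      then show ?thesis by (cases "0 \<le> x") (auto intro: rev_image_eqI)
    qed
    then show "set t \<subseteq> K \<union> uminus ` K \<and> length t = card K"
      using signed_wordsD(3)[OF t] by blast
  qed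
  then show ?thesis
    by (rule finite_subset) (use True in \<open>simp add: finite_lists_length_eq\<close>)
next
  case False
  then have "signed_words K = {}"
    by (auto simp: signed_words_def permutations_of_set_infinite)
  then show ?thesis by simp
qed

lemma strict_mono_on_nth_sorted_list_of_set:
  "strict_mono_on {..<card U} ((!) (sorted_list_of_set U))"
  by (rule strict_mono_onI)
     (metis lessThan_iff sorted_list_of_set.length_sorted_key_list_of_set sorted_wrt_nth_less
      strict_sorted_list_of_set)

lemma image_nth_sorted_list_of_set:
  assumes "finite U"
  shows "(!) (sorted_list_of_set U) ` {..<card U} = U"
  using assms nth_image[of "card U" "sorted_list_of_set U"]
  by (simp add: atLeast0LessThan)

text \<open>Standardization: the increasing bijection from \<open>{..<card U}\<close> onto
  \<open>U\<close> preserves inversions and descents.\<close>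

lemma sum_permutations_of_set_invs_dsc:
  fixes U :: "'a::linorder set"
  assumes "finite U"
  shows "(\<Sum>B\<in>permutations_of_set U. f (invs B) (dsc B))
       = (\<Sum>b\<in>permutations_of_set {..<card U}. f (invs b) (dsc b))"
proof -
  define h where "h = (!) (sorted_list_of_set U)"
  have mono: "strict_mono_on {..<card U} h"
    unfolding h_def by (rule strict_mono_on_nth_sorted_list_of_set)
  have inj: "inj_on h {..<card U}"
    using mono by (rule strict_mono_on_imp_inj_on)
  have U: "h ` {..<card U} = U"
    unfolding h_def using assms by (rule image_nth_sorted_list_of_set)
  have sub: "set b \<subseteq> {..<card U}" if "b \<in> permutations_of_set {..<card U}" for b
    using that by (auto simp: permutations_of_set_def)
  have "(\<Sum>B\<in>permutations_of_set U. f (invs B) (dsc B))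
      = (\<Sum>B\<in>map h ` permutations_of_set {..<card U}. f (invs B) (dsc B))"
    using permutations_of_set_image_inj[OF inj] U by simp
  also have "\<dots> = (\<Sum>b\<in>permutations_of_set {..<card U}. f (invs (map h b)) (dsc (map h b)))"
    by (subst sum.reindex) (auto intro!: inj_on_mapI inj_on_subset[OF inj] dest!: sub)
  also have "\<dots> = (\<Sum>b\<in>permutations_of_set {..<card U}. f (invs b) (dsc b))"
    by (intro sum.cong refl) (simp add: invs_map_strict_mono_on[OF mono] dsc_map_strict_mono_on[OF mono] sub)
  finally show ?thesis .
qed

lemma ex_odd_strict_mono_on:
  assumes "finite K" "\<And>x. x \<in> K \<Longrightarrow> (0::int) < x" "card K = k"
  obtains f where "strict_mono_on {- int k..int k} f" "f 0 = 0" "\<And>x. f (- x) = - f x"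
    "f ` {1..int k} = K"
proof
  \<comment> \<open>The leading \<open>0\<close> shifts the zero-based indices: \<open>h i\<close>
    is the \<open>i\<close>-th smallest element of \<open>K\<close>, and \<open>h 0 = 0\<close>
    permits the odd extension \<open>f\<close>.\<close>
  define h where "h = (!) (0 # sorted_list_of_set K)"
  define f where "f = (\<lambda>x. if 0 \<le> x then h (nat x) else - h (nat (- x)))"
  have h0: "h 0 = 0" by (simp add: h_def)
  have sorted: "sorted_wrt (<) (0 # sorted_list_of_set K)"
    using assms by auto
  have hm: "h i < h j" if "i < j" "j \<le> k" for i j
    unfolding h_def by (rule sorted_wrt_nth_less[OF sorted]) (use that assms in auto)
  show "f 0 = 0" "\<And>x. f (- x) = - f x"
    by (auto simp: f_def h0)
  have hp: "0 < h i" if "0 < i" "i \<le> k" for i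
    using hm[of 0 i] that h0 by simp
  show "strict_mono_on {- int k..int k} f"
  proof (rule strict_mono_onI)
    fix x y assume xy: "x \<in> {- int k..int k}" "y \<in> {- int k..int k}" "x < y"
    consider "0 \<le> x" | "x < 0" "0 < y" | "x < 0" "y = 0" | "y < 0" using xy by linarith
    then show "f x < f y"
    proof cases
      case 1 then show ?thesis using xy by (auto simp: f_def intro!: hm)
    next
      case 2
      then have "0 < h (nat y)" "0 < h (nat (- x))" using xy by (auto intro!: hp)
      then show ?thesis using 2 by (simp add: f_def)
    next
      case 3 then show ?thesis using xy hp[of "nat (-x)"] by (simp add: f_def h0)
    next
      case 4 then show ?thesis using xy by (auto simp: f_def intro!: hm)
    qed
  qed
  have "f ` {1..int k} = h ` {1..k}"
  proof -
    have "f ` {1..int k} = f ` (int ` {1..k})" by (simp add: image_int_atLeastAtMost)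
    also have "\<dots> = h ` {1..k}" unfolding image_image by (intro image_cong refl) (simp add: f_def)
    finally show ?thesis .
  qed
  also have "\<dots> = h ` Suc ` {..<k}" by (simp add: image_Suc_lessThan)
  also have "\<dots> = (!) (sorted_list_of_set K) ` {..<k}" by (simp add: image_image h_def)
  also have "\<dots> = K" using image_nth_sorted_list_of_set[OF assms(1)] assms(3) by simp
  finally show "f ` {1..int k} = K" .
qed

text \<open>Standardization for signed words. The odd relabelling fixes \<open>0\<close>, so it also
  preserves the comparison of \<open>0\<close> with the first letter.\<close>

lemma sum_signed_words_len_dsc:
  assumes "finite K" "\<And>x. x \<in> K \<Longrightarrow> (0::int) < x" "card K = k"
  shows "(\<Sum>A\<in>signed_words K. f (len A) (dsc (0 # A)))
       = (\<Sum>a\<in>signed_words {1..int k}. f (len a) (dsc (0 # a)))"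
proof -
  obtain h where mono: "strict_mono_on {- int k..int k} h" and h0: "h 0 = 0"
    and odd: "\<And>x. h (- x) = - h x" and K: "h ` {1..int k} = K"
    using ex_odd_strict_mono_on[OF assms] by metis
  let ?A = "{- int k..int k}"
  have inj: "inj_on h ?A" using mono by (rule strict_mono_on_imp_inj_on)
  have habs: "\<bar>h x\<bar> = h \<bar>x\<bar>" if "x \<in> ?A" for x
  proof (cases "0 < \<bar>x\<bar>")
    case True
    have "0 < h \<bar>x\<bar>" using strict_mono_onD[OF mono, of 0 "\<bar>x\<bar>"] True that h0 by auto
    then show ?thesis by (auto simp: abs_if odd split: if_splits)
  qed (use h0 in auto)
  have sub: "set a \<subseteq> ?A" if "a \<in> signed_words {1..int k}" for a
  proof
    fix x assume "x \<in> set a"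
    then have "\<bar>x\<bar> \<in> {1..int k}" using signed_wordsD(2)[OF that] by blast
    then show "x \<in> ?A" by auto
  qed
  have perms: "permutations_of_set K = map h ` permutations_of_set {1..int k}"
    using permutations_of_set_image_inj[of h "{1..int k}"] inj_on_subset[OF inj, of "{1..int k}"] K by auto
  have abs_map: "map abs (map h a) = map h (map abs a)" if "set a \<subseteq> ?A" for a
    using that habs by auto
  have img: "map h ` signed_words {1..int k} = signed_words K"
  proof (intro equalityI subsetI)
    fix t assume "t \<in> map h ` signed_words {1..int k}"
    then obtain a where a: "a \<in> signed_words {1..int k}" "t = map h a" by auto
    then show "t \<in> signed_words K"
      using abs_map[OF sub[OF a(1)]] unfolding signed_words_def perms by (auto simp del: map_map)
  next
    fix t assume t: "t \<in> signed_words K"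
    have "set t \<subseteq> h ` ?A"
    proof
      fix x assume "x \<in> set t"
      then have "\<bar>x\<bar> \<in> h ` {1..int k}" using signed_wordsD(2)[OF t] K by auto
      then obtain y where y: "\<bar>x\<bar> = h y" "y \<in> {1..int k}" by auto
      then have "x = h y \<or> x = h (- y)" by (auto simp: odd)
      then show "x \<in> h ` ?A" using y(2) by auto
    qed
    then have "map h (map (inv_into ?A h) t) = t"
      unfolding map_map by (intro map_idI) (auto simp: f_inv_into_f)
    moreover have "set (map (inv_into ?A h) t) \<subseteq> ?A"
      using \<open>set t \<subseteq> h ` ?A\<close> by (auto simp only: set_map intro: inv_into_into)
    ultimately obtain a where a: "t = map h a" "set a \<subseteq> ?A" by metis
    \<comment> \<open>Only the image under \<open>h\<close> is known to be a permutation;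
      injectivity of \<open>h\<close> on \<open>?A\<close> pulls this back to
      \<open>map abs a\<close>.\<close>
    have "map h (map abs a) \<in> map h ` permutations_of_set {1..int k}"
      using t abs_map[OF a(2)] unfolding signed_words_def perms a(1) by (simp del: map_map)
    then obtain b where b: "map h (map abs a) = map h b" "b \<in> permutations_of_set {1..int k}" by auto
    have "map abs a = b"
    proof (rule map_inj_on[OF b(1)], rule inj_on_subset[OF inj])
      show "set (map abs a) \<union> set b \<subseteq> ?A"
        using a(2) b(2) by (auto simp: permutations_of_set_def subset_iff abs_if)
    qed
    then show "t \<in> map h ` signed_words {1..int k}"
      using a(1) b(2) by (auto simp: signed_words_def)
  qed
  have "(\<Sum>A\<in>signed_words K. f (len A) (dsc (0 # A)))
     = (\<Sum>a\<in>signed_words {1..int k}. f (len (map h a)) (dsc (0 # map h a)))"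
    unfolding img[symmetric]
    by (subst sum.reindex) (auto intro!: inj_on_mapI inj_on_subset[OF inj] dest!: sub)
  also have "\<dots> = (\<Sum>a\<in>signed_words {1..int k}. f (len a) (dsc (0 # a)))"
  proof (intro sum.cong refl)
    fix a assume a: "a \<in> signed_words {1..int k}"
    have "len (map h a) = len a"
      by (rule len_map_strict_mono_on[OF mono sub[OF a]]) (auto simp: h0 odd)
    moreover have "dsc (map h (0 # a)) = dsc (0 # a)"
      by (rule dsc_map_strict_mono_on[OF mono]) (use sub[OF a] in auto)
    ultimately show "f (len (map h a)) (dsc (0 # map h a)) = f (len a) (dsc (0 # a))"
      by (simp add: h0)
  qed
  finally show ?thesis .
qed

text \<open>The possible sets of letters of a suffix of length \<open>l\<close> of a signed word on
  \<open>{1..int N}\<close>; injectivity of \<open>abs\<close> excludes having both \<open>x\<close>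
  and \<open>- x\<close>.\<close>

definition signed_sets :: "nat \<Rightarrow> nat \<Rightarrow> int set set" where
  "signed_sets N l = {U. inj_on abs U \<and> abs ` U \<subseteq> {1..int N} \<and> card U = l}"

lemma finite_abs_image_imp: "abs ` U \<subseteq> {1..int N} \<Longrightarrow> finite U"
  by (rule finite_subset[of _ "{- int N..int N}"]) force+

lemma finite_signed_sets: "finite (signed_sets N l)"
  by (rule finite_subset[of _ "Pow {- int N..int N}"]) (force simp: signed_sets_def)+

text \<open>The length of the shortest word \<open>A @ B\<close> with \<open>set B = U\<close>: both factors increasing, \<open>A\<close> positive.\<close>

definition shuffle_len :: "nat \<Rightarrow> int set \<Rightarrow> nat" where
  "shuffle_len N U = len (sorted_list_of_set ({1..int N} - abs ` U) @ sorted_list_of_set U)"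

text \<open>The negative pairs inside \<open>B\<close> and the interaction of \<open>A\<close> with
  \<open>B\<close> depend only on \<open>U\<close>, so they can be read off the sorted word. What
  remains is \<open>len A\<close> and the inversions of \<open>B\<close>.\<close>

lemma len_append_shuffle:
  assumes U: "U \<in> signed_sets N l"
    and A: "A \<in> signed_words ({1..int N} - abs ` U)" and B: "B \<in> permutations_of_set U"
  shows "len (A @ B) = shuffle_len N U + len A + invs B"
proof -
  let ?K = "{1..int N} - abs ` U"
  have fU: "finite U" using U by (auto simp: signed_sets_def intro: finite_abs_image_imp)
  have B': "distinct B" "set B = U" using B by (auto simp: permutations_of_set_def)
  have "(\<Sum>x\<leftarrow>A. \<Sum>y\<leftarrow>B. cross x y)
      = (\<Sum>x\<leftarrow>sorted_list_of_set ?K. \<Sum>y\<leftarrow>sorted_list_of_set U. cross x y)"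
    by (rule cross_sum_distinct_cong) (use signed_wordsD[OF A] B' fU in auto)
  moreover have "len (sorted_list_of_set ?K) = 0"
    by (rule len_pos_sorted) auto
  moreover have "neg_pairs B = neg_pairs (sorted_list_of_set U)"
    by (rule neg_pairs_distinct_cong) (use B' fU in auto)
  ultimately show ?thesis
    by (simp add: shuffle_len_def len_append len_eq_invs_neg_pairs[of B]
        len_eq_invs_neg_pairs[of "sorted_list_of_set U"] invs_sorted)
qed

text \<open>The factor left over once \<open>A\<close> and \<open>B\<close> are both standardized;
  it is common to all \<open>U\<close> in \<open>signed_sets (k + l) l\<close>.\<close>

definition word_factor :: "'a::comm_ring_1 \<Rightarrow> nat \<Rightarrow> nat \<Rightarrow> (bool list \<Rightarrow> bool list \<Rightarrow> 'a) \<Rightarrow> 'a" where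
  "word_factor q k l \<phi> =
     (\<Sum>a\<in>signed_words {1..int k}. \<Sum>b\<in>permutations_of_set {..<l}.
        q ^ len a * q ^ invs b * \<phi> (dsc (0 # a)) (dsc b))"

lemma signed_words_split_bij:
  assumes "k \<le> N"
  shows "bij_betw (\<lambda>(U, A, B). A @ B)
     (SIGMA U:signed_sets N (N - k). signed_words ({1..int N} - abs ` U) \<times> permutations_of_set U)
     (signed_words {1..int N})"
proof (rule bij_betw_byWitness[where f' = "\<lambda>w. (set (drop k w), take k w, drop k w)"])
  let ?S = "SIGMA U:signed_sets N (N - k). signed_words ({1..int N} - abs ` U) \<times> permutations_of_set U"
  have lenA: "length A = k"
    if "U \<in> signed_sets N (N - k)" "A \<in> signed_words ({1..int N} - abs ` U)" for U A
  proof -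
    have "card (abs ` U) = N - k" "abs ` U \<subseteq> {1..int N}"
      using that(1) by (auto simp: signed_sets_def card_image)
    then show ?thesis
      using signed_wordsD(3)[OF that(2)] assms card_Diff_subset[of "abs ` U" "{1..int N}"] 
      by (simp add: finite_subset)
  qed
  show "\<forall>a\<in>?S. (\<lambda>w. (set (drop k w), take k w, drop k w)) ((\<lambda>(U, A, B). A @ B) a) = a"
    using lenA by (auto simp: permutations_of_set_def)
  show "\<forall>w\<in>signed_words {1..int N}. (\<lambda>(U, A, B). A @ B) (set (drop k w), take k w, drop k w) = w"
    by simp
  show "(\<lambda>(U, A, B). A @ B) ` ?S \<subseteq> signed_words {1..int N}"
  proof clarify
    fix U A B
    assume *: "U \<in> signed_sets N (N - k)" "A \<in> signed_words ({1..int N} - abs ` U)"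
      "B \<in> permutations_of_set U"
    then have B: "set B = U" "distinct (map abs B)"
      by (auto simp: signed_sets_def permutations_of_set_def distinct_map)
    have "distinct (map abs (A @ B))"
      using signed_wordsD(1,2)[OF *(2)] B by auto
    moreover have "abs ` set (A @ B) = {1..int N}"
      using signed_wordsD(2)[OF *(2)] B(1) *(1) unfolding signed_sets_def set_append image_Un by blast
    ultimately show "A @ B \<in> signed_words {1..int N}"
      by (simp add: signed_words_def permutations_of_set_def)
  qed
  show "(\<lambda>w. (set (drop k w), take k w, drop k w)) ` signed_words {1..int N} \<subseteq> ?S"
  proof clarify
    fix w assume w: "w \<in> signed_words {1..int N}"
    note D = signed_wordsD[OF w]
    have split: "set w = set (take k w) \<union> set (drop k w)"
      by (metis append_take_drop_id set_append)
    have dist: "distinct (map abs (take k w) @ map abs (drop k w))"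
      using D(1) by (metis append_take_drop_id map_append)
    have "{1..int N} - abs ` set (drop k w) = abs ` set (take k w)"
      using dist D(2) split by auto
    moreover have "card (set (drop k w)) = N - k"
      using D by (simp add: distinct_card)
    moreover have "abs ` set (drop k w) \<subseteq> {1..int N}" using D(2) split by auto
    ultimately show "set (drop k w) \<in> signed_sets N (N - k) \<and>
        (take k w, drop k w) \<in> signed_words ({1..int N} - abs ` set (drop k w)) \<times> permutations_of_set (set (drop k w))"
      using dist D(4) by (auto simp: signed_sets_def signed_words_def permutations_of_set_def distinct_map)
  qed
qed

text \<open>The weight \<open>z\<close> sees only \<open>U = set (drop k w)\<close>. For fixed
  \<open>U\<close>, the sum over \<open>A\<close> and \<open>B\<close> standardizes to a factor
  independent of \<open>U\<close>, which can be pulled out.\<close>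

lemma sum_signed_words_split:
  fixes q :: "'a::comm_ring_1"
  assumes "k \<le> N"
  shows "(\<Sum>w\<in>signed_words {1..int N}. q ^ len w * z (set (drop k w)) * \<phi> (dsc (0 # take k w)) (dsc (drop k w)))
       = (\<Sum>U\<in>signed_sets N (N - k). q ^ shuffle_len N U * z U) * word_factor q k (N - k) \<phi>"
proof -
  let ?S = "SIGMA U:signed_sets N (N - k). signed_words ({1..int N} - abs ` U) \<times> permutations_of_set U"
  let ?g = "\<lambda>w. q ^ len w * z (set (drop k w)) * \<phi> (dsc (0 # take k w)) (dsc (drop k w))"
  have cardK: "card ({1..int N} - abs ` U) = k" if "U \<in> signed_sets N (N - k)" for U
  proof -
    have "card (abs ` U) = N - k" "abs ` U \<subseteq> {1..int N}"
      using that by (auto simp: signed_sets_def card_image)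
    then show ?thesis
      using assms card_Diff_subset[of "abs ` U" "{1..int N}"] by (simp add: finite_subset)
  qed
  have "(\<Sum>w\<in>signed_words {1..int N}. ?g w) = (\<Sum>p\<in>?S. ?g ((\<lambda>(U, A, B). A @ B) p))"
    by (rule sum.reindex_bij_betw[OF signed_words_split_bij[OF assms], symmetric])
  also have "\<dots> = (\<Sum>(U, A, B)\<in>?S. q ^ shuffle_len N U * z U *
      (q ^ len A * q ^ invs B * \<phi> (dsc (0 # A)) (dsc B)))"
  proof (intro sum.cong refl, clarify)
    fix U A B assume *: "U \<in> signed_sets N (N - k)" "A \<in> signed_words ({1..int N} - abs ` U)"
      "B \<in> permutations_of_set U"
    have "length A = k" using signed_wordsD(3)[OF *(2)] cardK[OF *(1)] by simp
    moreover have "set B = U" using *(3) by (simp add: permutations_of_set_def)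
    ultimately show "?g (A @ B) = q ^ shuffle_len N U * z U * (q ^ len A * q ^ invs B * \<phi> (dsc (0 # A)) (dsc B))"
      by (simp add: len_append_shuffle[OF *] power_add mult_ac)
  qed
  also have "\<dots> = (\<Sum>U\<in>signed_sets N (N - k). \<Sum>(A, B)\<in>signed_words ({1..int N} - abs ` U) \<times> permutations_of_set U.
      q ^ shuffle_len N U * z U * (q ^ len A * q ^ invs B * \<phi> (dsc (0 # A)) (dsc B)))"
    by (subst sum.Sigma) (auto simp: finite_signed_sets finite_signed_words)
  also have "\<dots> = (\<Sum>U\<in>signed_sets N (N - k). q ^ shuffle_len N U * z U *
      (\<Sum>A\<in>signed_words ({1..int N} - abs ` U). \<Sum>B\<in>permutations_of_set U. 
         q ^ len A * q ^ invs B * \<phi> (dsc (0 # A)) (dsc B)))"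
    by (simp add: sum.cartesian_product sum_distrib_left case_prod_unfold)
  also have "\<dots> = (\<Sum>U\<in>signed_sets N (N - k). q ^ shuffle_len N U * z U * word_factor q k (N - k) \<phi>)"
  proof (intro sum.cong refl arg_cong[of _ _ "(*) _"])
    fix U assume U: "U \<in> signed_sets N (N - k)"
    have fU: "finite U" "card U = N - k"
      using U by (auto simp: signed_sets_def intro: finite_abs_image_imp)
    have "(\<Sum>A\<in>signed_words ({1..int N} - abs ` U). \<Sum>B\<in>permutations_of_set U.
         q ^ len A * q ^ invs B * \<phi> (dsc (0 # A)) (dsc B))
       = (\<Sum>A\<in>signed_words ({1..int N} - abs ` U). \<Sum>b\<in>permutations_of_set {..<N - k}.
         q ^ len A * q ^ invs b * \<phi> (dsc (0 # A)) (dsc b))"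
      by (intro sum.cong refl)
         (subst sum_permutations_of_set_invs_dsc[OF fU(1)], simp only: fU(2))
    also have "\<dots> = word_factor q k (N - k) \<phi>"
      unfolding word_factor_def
      by (rule sum_signed_words_len_dsc[where f = "\<lambda>i d. \<Sum>b\<in>permutations_of_set {..<N - k}. q ^ i * q ^ invs b * \<phi> d (dsc b)"])
         (auto simp: cardK[OF U])
    finally show "(\<Sum>A\<in>signed_words ({1..int N} - abs ` U). \<Sum>B\<in>permutations_of_set U.
         q ^ len A * q ^ invs B * \<phi> (dsc (0 # A)) (dsc B)) = word_factor q k (N - k) \<phi>" .
  qed
  finally show ?thesis by (simp add: sum_distrib_right)
qed

section \<open>The shuffle generating function\<close>

text \<open>With \<open>N = k + l\<close> this is the \<open>C(k, l)\<close> of the opening outline: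
  the length enumerator of the minimal coset representatives of \<open>B_N\<close> modulo
  \<open>B_k\<close> times \<open>S_l\<close>.\<close>

definition shuffle_gf :: "'a::comm_ring_1 \<Rightarrow> nat \<Rightarrow> nat \<Rightarrow> 'a" where
  "shuffle_gf q N l = (\<Sum>U\<in>signed_sets N l. q ^ shuffle_len N U)"

lemma signed_sets_0 [simp]: "signed_sets N 0 = {{}}"
  by (auto simp: signed_sets_def dest: finite_abs_image_imp)

lemma signed_setsD:
  assumes "U \<in> signed_sets N l"
  shows "finite U" "card U = l" "abs ` U \<subseteq> {1..int N}" "card ({1..int N} - abs ` U) = N - l" "l \<le> N"
proof -
  show *: "finite U" "card U = l" "abs ` U \<subseteq> {1..int N}"
    using assms by (auto simp: signed_sets_def dest: finite_abs_image_imp)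
  have c: "card (abs ` U) = l" using assms by (auto simp: signed_sets_def card_image)
  then show "card ({1..int N} - abs ` U) = N - l"
    using * card_Diff_subset[of "abs ` U" "{1..int N}"] by simp
  show "l \<le> N" using card_mono[OF _ *(3)] c by simp
qed

lemma signed_sets_bounds:
  assumes "U \<in> signed_sets N l" "x \<in> U"
  shows "- int N \<le> x" "x \<le> int N" "x \<noteq> 0"
proof -
  have "\<bar>x\<bar> \<in> {1..int N}" using assms by (auto simp: signed_sets_def)
  then show "- int N \<le> x" "x \<le> int N" "x \<noteq> 0" by auto
qed

text \<open>The letter of absolute value \<open>N + 1\<close> either occurs in the suffix, with one
  of two signs, or belongs to the prefix.\<close>

lemma signed_sets_Suc:
  "signed_sets (Suc N) (Suc l) =
     insert (1 + int N) ` signed_sets N l \<union> insert (- 1 - int N) ` signed_sets N l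
     \<union> signed_sets N (Suc l)" (is "?L = ?P \<union> ?Q \<union> ?R")
proof (intro equalityI subsetI)
  fix U assume U: "U \<in> ?L"
  note D = signed_setsD[OF U]
  have inj: "inj_on abs U" using U by (simp add: signed_sets_def)
  have rem: "U - {x} \<in> signed_sets N l" if "x \<in> U" "\<bar>x\<bar> = 1 + int N" for x
  proof -
    have "\<bar>y\<bar> \<in> {1..int N}" if "y \<in> U - {x}" for y
    proof -
      have "\<bar>y\<bar> \<noteq> \<bar>x\<bar>" using inj that \<open>x \<in> U\<close> by (auto simp: inj_on_def)
      moreover have "\<bar>y\<bar> \<in> {1..int (Suc N)}" using D(3) that by blast
      ultimately show ?thesis using \<open>\<bar>x\<bar> = _\<close> by auto
    qed
    then have "abs ` (U - {x}) \<subseteq> {1..int N}" by blast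
    then show ?thesis
      using inj D(1,2) that(1) by (simp add: signed_sets_def inj_on_diff)
  qed
  consider "1 + int N \<in> U" | "- 1 - int N \<in> U" | "1 + int N \<notin> U" "- 1 - int N \<notin> U" by blast
  then show "U \<in> ?P \<union> ?Q \<union> ?R"
  proof cases
    case 1
    then have "U \<in> ?P"
      using rem[OF 1] by (intro image_eqI[of _ _ "U - {1 + int N}"]) auto
    then show ?thesis by blast
  next
    case 2
    then have "U \<in> ?Q"
      using rem[OF 2] by (intro image_eqI[of _ _ "U - {- 1 - int N}"]) auto
    then show ?thesis by blast
  next
    case 3
    have "\<bar>y\<bar> \<in> {1..int N}" if "y \<in> U" for y
    proof -
      have "\<bar>y\<bar> \<in> {1..int (Suc N)}" using D(3) that by blast
      moreover have "\<bar>y\<bar> \<noteq> 1 + int N" using 3 that by (metis abs_if diff_conv_add_uminus minus_add_distrib minus_minus)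
      ultimately show ?thesis by auto
    qed
    then show ?thesis using inj D by (auto simp: signed_sets_def)
  qed
next
  fix U assume "U \<in> ?P \<union> ?Q \<union> ?R"
  moreover have "insert x V \<in> ?L" if V: "V \<in> signed_sets N l" and "\<bar>x\<bar> = 1 + int N" for V x
  proof -
    note D = signed_setsD[OF V]
    have "\<bar>x\<bar> \<notin> abs ` V" using D(3) that(2) by auto
    then have "x \<notin> V" by blast
    moreover have "abs ` insert x V \<subseteq> {1..int (Suc N)}" using D(3) that(2) by force
    ultimately show ?thesis
      using V D(1,2) \<open>\<bar>x\<bar> \<notin> abs ` V\<close> by (auto simp: signed_sets_def)
  qed
  moreover have "V \<in> ?L" if "V \<in> ?R" for V
    using that by (force simp: signed_sets_def)
  ultimately show "U \<in> ?L" by force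
qed

lemma sum_signed_sets_Suc:
  "(\<Sum>U\<in>signed_sets (Suc N) (Suc l). f U) =
     (\<Sum>U\<in>signed_sets N l. f (insert (1 + int N) U)) +
     (\<Sum>U\<in>signed_sets N l. f (insert (- 1 - int N) U)) + (\<Sum>U\<in>signed_sets N (Suc l). f U)"
proof -
  have notin: "x \<notin> U" if "U \<in> signed_sets N m" "\<bar>x\<bar> = 1 + int N" for x U m
    using signed_sets_bounds[OF that(1), of x] that(2) by (auto simp: abs_if split: if_splits)
  have inj: "inj_on (insert x) (signed_sets N l)" if "\<bar>x\<bar> = 1 + int N" for x
    by (rule inj_onI) (metis notin that insert_ident)
  have "(\<Sum>U\<in>signed_sets (Suc N) (Suc l). f U) =
     (\<Sum>U\<in>insert (1 + int N) ` signed_sets N l. f U) +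
     (\<Sum>U\<in>insert (- 1 - int N) ` signed_sets N l. f U) + (\<Sum>U\<in>signed_sets N (Suc l). f U)"
    unfolding signed_sets_Suc
  proof (subst sum.union_disjoint, goal_cases)
    case 3
    have "insert x V \<notin> signed_sets N (Suc l)" if "\<bar>x\<bar> = 1 + int N" for x V
      using notin[OF _ that] by blast
    then show ?case by auto
  next
    case 4
    show ?case
    proof (subst sum.union_disjoint, goal_cases)
      case 3
      have "insert (1 + int N) U \<noteq> insert (- 1 - int N) V" if "V \<in> signed_sets N l" for U V
      proof
        assume "insert (1 + int N) U = insert (- 1 - int N) V"
        then have "1 + int N \<in> insert (- 1 - int N) V" by blast
        then have "1 + int N \<in> V" by auto
        then show False using notin[OF that] by auto
      qed
      then show ?case by blast
    qed (auto simp: finite_signed_sets)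
  qed (auto simp: finite_signed_sets)
  then show ?thesis by (simp add: sum.reindex inj)
qed

section \<open>The recursion of q-Pascal type\<close>

lemma sum_list_const_nat: "(\<Sum>x\<leftarrow>xs. c) = length xs * (c::nat)"
  by (induction xs) auto

text \<open>The letter \<open>m\<close> contributes nothing with the letters before it and one
  inversion with each letter after it.\<close>

lemma len_insert_max:
  assumes "\<And>x. x \<in> set A \<union> set B \<Longrightarrow> \<bar>x\<bar> < m" "0 < m"
  shows "len (A @ m # B) = len (A @ B) + length B"
proof -
  have "(\<Sum>x\<leftarrow>A. cross x m) = 0"
    using assms by (force simp: sum_list_eq_0_iff cross_def)
  moreover have "(\<Sum>y\<leftarrow>B. cross m y) = (\<Sum>y\<leftarrow>B. 1)"
    using assms by (intro arg_cong[of _ _ sum_list] map_cong) (force simp: cross_def)+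
  ultimately show ?thesis
    using assms(2) by (simp add: len_append sum_list_addf sum_list_const_nat)
qed

text \<open>A letter \<open>x\<close> before \<open>- m\<close> satisfies both
  \<open>- m < x\<close> and \<open>- m < - x\<close>, hence the factor \<open>2\<close>. Each later
  letter counts once, being below \<open>m\<close>, and the sign of \<open>- m\<close> gives the
  \<open>1\<close>.\<close>

lemma len_insert_min:
  assumes "\<And>x. x \<in> set A \<union> set B \<Longrightarrow> \<bar>x\<bar> < m" "0 < m"
  shows "len (A @ (- m) # B) = len (A @ B) + 2 * length A + length B + 1"
proof -
  have "(\<Sum>x\<leftarrow>A. cross x (- m)) = (\<Sum>x\<leftarrow>A. 2)"
    using assms by (intro arg_cong[of _ _ sum_list] map_cong) (force simp: cross_def)+
  moreover have "(\<Sum>y\<leftarrow>B. cross (- m) y) = (\<Sum>y\<leftarrow>B. 1)"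
    using assms by (intro arg_cong[of _ _ sum_list] map_cong) (force simp: cross_def)+
  ultimately show ?thesis
    using assms(2) by (simp add: len_append sum_list_addf sum_list_const_nat)
qed

lemma sorted_list_of_set_insert_max:
  fixes x :: "'a::linorder"
  assumes "finite A" "\<And>y. y \<in> A \<Longrightarrow> y < x"
  shows "sorted_list_of_set (insert x A) = sorted_list_of_set A @ [x]"
proof (rule sorted_distinct_set_unique)
  show "sorted (sorted_list_of_set A @ [x])"
    using assms by (auto simp: sorted_append less_imp_le)
qed (use assms in \<open>auto simp del: sorted_list_of_set.sorted_key_list_of_set_insert_remove\<close>)

lemma sorted_list_of_set_insert_min:
  fixes x :: "'a::linorder"
  assumes "finite A" "\<And>y. y \<in> A \<Longrightarrow> x < y"
  shows "sorted_list_of_set (insert x A) = x # sorted_list_of_set A"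
proof (rule sorted_distinct_set_unique)
  show "sorted (x # sorted_list_of_set A)"
    using assms by (auto simp: less_imp_le)
qed (use assms in \<open>auto simp del: sorted_list_of_set.sorted_key_list_of_set_insert_remove\<close>)

lemma shuffle_len_max:
  assumes U: "U \<in> signed_sets N l"
  shows "shuffle_len (Suc N) (insert (1 + int N) U) = shuffle_len N U"
proof -
  let ?K = "{1..int N} - abs ` U"
  note D = signed_setsD[OF U] and b = signed_sets_bounds[OF U]
  have K: "{1..int (Suc N)} - abs ` insert (1 + int N) U = ?K"
    using D(3) by auto
  have "sorted_list_of_set (insert (1 + int N) U) = sorted_list_of_set U @ [1 + int N]"
    by (rule sorted_list_of_set_insert_max) (use D b in force)+
  moreover have "len ((sorted_list_of_set ?K @ sorted_list_of_set U) @ (1 + int N) # [])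
      = len ((sorted_list_of_set ?K @ sorted_list_of_set U) @ []) + length ([] :: int list)"
    by (rule len_insert_max) (use D b in \<open>force simp: abs_if\<close>)+
  ultimately show ?thesis unfolding shuffle_len_def K by simp
qed

lemma shuffle_len_min:
  assumes U: "U \<in> signed_sets N l"
  shows "shuffle_len (Suc N) (insert (- 1 - int N) U) = shuffle_len N U + 2 * (N - l) + l + 1"
proof -
  let ?K = "{1..int N} - abs ` U"
  note D = signed_setsD[OF U] and b = signed_sets_bounds[OF U]
  have K: "{1..int (Suc N)} - abs ` insert (- 1 - int N) U = ?K"
    using D(3) by auto
  have "sorted_list_of_set (insert (- 1 - int N) U) = (- 1 - int N) # sorted_list_of_set U"
    by (rule sorted_list_of_set_insert_min) (use D b in force)+
  moreover have "len (sorted_list_of_set ?K @ (- (1 + int N)) # sorted_list_of_set U)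
      = len (sorted_list_of_set ?K @ sorted_list_of_set U) + 2 * length (sorted_list_of_set ?K)
        + length (sorted_list_of_set U) + 1"
    by (rule len_insert_min) (use D b in \<open>force simp: abs_if\<close>)+
  ultimately show ?thesis unfolding shuffle_len_def K by (simp add: D)
qed

text \<open>The letter \<open>N + 1\<close> now ends the sorted prefix and interacts with all
  \<open>l\<close> letters of the suffix.\<close>

lemma shuffle_len_absent:
  assumes U: "U \<in> signed_sets N l"
  shows "shuffle_len (Suc N) U = shuffle_len N U + l"
proof -
  let ?K = "{1..int N} - abs ` U"
  note D = signed_setsD[OF U] and b = signed_sets_bounds[OF U]
  have K: "{1..int (Suc N)} - abs ` U = insert (1 + int N) ?K"
    using D(3) by auto
  have "sorted_list_of_set (insert (1 + int N) ?K) = sorted_list_of_set ?K @ [1 + int N]"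
    by (rule sorted_list_of_set_insert_max) auto
  moreover have "len (sorted_list_of_set ?K @ (1 + int N) # sorted_list_of_set U)
      = len (sorted_list_of_set ?K @ sorted_list_of_set U) + length (sorted_list_of_set U)"
    by (rule len_insert_max) (use D b in \<open>force simp: abs_if\<close>)+
  ultimately show ?thesis unfolding shuffle_len_def K by (simp add: D)
qed

text \<open>The weight \<open>z\<close> records where the letter of absolute value
  \<open>N + 1\<close> sits. Constant \<open>z\<close> gives the recursion for
  \<open>shuffle_gf\<close>; two other choices give the weighted sums arising from
  \<open>fmaj\<close>.\<close>

lemma sum_shuffle_len_Suc:
  fixes q :: "'a::comm_ring_1"
  shows "(\<Sum>U\<in>signed_sets (Suc N) (Suc l). q ^ shuffle_len (Suc N) U * z (1 + int N \<in> U) (- 1 - int N \<in> U))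
    = (z True False + q ^ (2 * (N - l) + l + 1) * z False True) * shuffle_gf q N l
      + q ^ Suc l * z False False * shuffle_gf q N (Suc l)"
proof -
  have notin: "1 + int N \<notin> U" "- 1 - int N \<notin> U" if "U \<in> signed_sets N m" for U m
    using signed_sets_bounds[OF that, of "1 + int N"] signed_sets_bounds[OF that, of "- 1 - int N"] by auto
  have "(\<Sum>U\<in>signed_sets N l. q ^ shuffle_len (Suc N) (insert (1 + int N) U) *
          z (1 + int N \<in> insert (1 + int N) U) (- 1 - int N \<in> insert (1 + int N) U))
       = z True False * shuffle_gf q N l"
    unfolding shuffle_gf_def sum_distrib_left
    by (intro sum.cong refl) (simp add: shuffle_len_max notin)
  moreover have "(\<Sum>U\<in>signed_sets N l. q ^ shuffle_len (Suc N) (insert (- 1 - int N) U) *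
          z (1 + int N \<in> insert (- 1 - int N) U) (- 1 - int N \<in> insert (- 1 - int N) U))
       = q ^ (2 * (N - l) + l + 1) * z False True * shuffle_gf q N l"
    unfolding shuffle_gf_def sum_distrib_left
    by (intro sum.cong refl) (simp add: shuffle_len_min notin power_add mult_ac)
  moreover have "(\<Sum>U\<in>signed_sets N (Suc l). q ^ shuffle_len (Suc N) U * z (1 + int N \<in> U) (- 1 - int N \<in> U))
       = q ^ Suc l * z False False * shuffle_gf q N (Suc l)"
    unfolding shuffle_gf_def sum_distrib_left
    by (intro sum.cong refl) (simp add: shuffle_len_absent notin power_add mult_ac)
  ultimately show ?thesis
    by (simp add: sum_signed_sets_Suc algebra_simps)
qed

lemma shuffle_gf_Suc:
  fixes q :: "'a::comm_ring_1"
  shows "shuffle_gf q (Suc N) (Suc l)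
    = (1 + q ^ (2 * (N - l) + l + 1)) * shuffle_gf q N l + q ^ Suc l * shuffle_gf q N (Suc l)"
  using sum_shuffle_len_Suc[where q = q and N = N and l = l and z = "\<lambda>_ _. 1"] by (simp add: shuffle_gf_def)

lemma shuffle_gf_0 [simp]: "shuffle_gf q N 0 = 1"
proof -
  have "shuffle_len N {} = 0"
    unfolding shuffle_len_def by (rule len_pos_sorted) auto
  then show ?thesis by (simp add: shuffle_gf_def)
qed

lemma shuffle_gf_eq_0:
  assumes "N < l"
  shows "shuffle_gf q N l = 0"
proof -
  have "signed_sets N l = {}"
    using assms signed_setsD(5)[of _ N l] by (meson equals0I not_less)
  then show ?thesis by (simp add: shuffle_gf_def)
qed

text \<open>With \<open>k = N - j\<close> and \<open>l = j + 1\<close> this is the identity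
  announced in the outline. The recursion and the induction hypothesis at two neighbouring indices
  prove it without division, hence over any commutative ring.\<close>

lemma shuffle_gf_ratio:
  fixes q :: "'a::comm_ring_1"
  assumes "j \<le> N"
  shows "(1 - q ^ (2 * (N - j))) * shuffle_gf q N j = (1 - q ^ Suc j) * shuffle_gf q N (Suc j)"
  using assms
proof (induction N arbitrary: j)
  case 0
  then show ?case by (simp add: shuffle_gf_eq_0)
next
  case (Suc N)
  show ?case
  proof (cases j)
    case 0
    have "(1 - q) * shuffle_gf q (Suc N) 1
      = (1 - q) * (1 + q ^ (2 * N + 1)) + q * ((1 - q) * shuffle_gf q N 1)"
      using shuffle_gf_Suc[of q N 0] by (simp add: algebra_simps)
    also have "(1 - q) * shuffle_gf q N 1 = 1 - q ^ (2 * N)"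
      using Suc.IH[of 0] by simp
    finally show ?thesis using 0 by (simp add: algebra_simps)
  next
    case (Suc i)
    show ?thesis
    proof (cases "i = N")
      case True
      \<comment> \<open>Both sides vanish: the left has the factor \<open>1 - q ^ 0\<close>, and on
        the right the suffix would be longer than the word.\<close>
      then show ?thesis using Suc by (simp add: shuffle_gf_eq_0)
    next
      case False
      then obtain r where N: "N = i + r + 1"
        using Suc Suc.prems less_imp_Suc_add[of i N] by auto
      \<comment> \<open>Facts \<open>1\<close> and \<open>2\<close> express the terms with indices
        \<open>i\<close> and \<open>i + 2\<close> through \<open>X\<close>. Both sides then equal
        \<open>(1 - q ^ (2 * r + 2 * i + 4)) * X\<close>.\<close>
      define X where "X = shuffle_gf q N (i + 1)"
      have 1: "(1 - q ^ (2 * (r + 1))) * shuffle_gf q N i = (1 - q ^ (i + 1)) * X"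
        using Suc.IH[of i] by (simp add: N X_def)
      have 2: "(1 - q ^ (i + 2)) * shuffle_gf q N (i + 2) = (1 - q ^ (2 * r)) * X"
        using Suc.IH[of "i + 1"] by (simp add: N X_def)
      have "(1 - q ^ (2 * (r + 1))) * shuffle_gf q (Suc N) (i + 1)
        = (1 + q ^ (2 * (r + 1) + i + 1)) * ((1 - q ^ (2 * (r + 1))) * shuffle_gf q N i)
          + q ^ (i + 1) * (1 - q ^ (2 * (r + 1))) * X"
        using shuffle_gf_Suc[of q N i] by (simp add: N X_def algebra_simps)
      also have "\<dots> = (1 - q ^ (2 * r + 2 * i + 4)) * X"
        unfolding 1 by (simp add: algebra_simps power_add power2_eq_square eval_nat_numeral)
      also have "\<dots> = (1 + q ^ (2 * r + i + 2)) * (1 - q ^ (i + 2)) * X + q ^ (i + 2) * ((1 - q ^ (2 * r)) * X)"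
        by (simp add: algebra_simps power_add power2_eq_square eval_nat_numeral)
      also have "\<dots> = (1 - q ^ (i + 2)) * shuffle_gf q (Suc N) (i + 2)"
        unfolding 2[symmetric]
        using shuffle_gf_Suc[of q N "i + 1"] by (simp add: N X_def algebra_simps)
      finally show ?thesis by (simp add: Suc N)
    qed
  qed
qed

text \<open>The case of a positive inserted letter: a new descent at \<open>N\<close> raises
  \<open>fmaj\<close> by \<open>2 * N\<close> and occurs exactly when \<open>N\<close> lies in the
  suffix. In the sum this has the same effect as the length gain \<open>l\<close>.\<close>

lemma sum_shuffle_len_pos:
  fixes q :: "'a::comm_ring_1"
  assumes "l \<le> N"
  shows "(\<Sum>U\<in>signed_sets N l. q ^ shuffle_len N U * q ^ (if int N \<in> U then 2 * N else 0))
       = q ^ l * shuffle_gf q N l"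
proof (cases l)
  case 0
  then show ?thesis using shuffle_gf_0[of q N] by (simp add: shuffle_gf_def)
next
  case (Suc j)
  then obtain k where N: "N = Suc (j + k)" using assms by (metis add_Suc le_Suc_ex)
  have r: "q ^ Suc j * (1 - q ^ (2 * k)) * shuffle_gf q (j + k) j = q ^ Suc j * (1 - q ^ Suc j) * shuffle_gf q (j + k) (Suc j)"
    using shuffle_gf_ratio[of j "j + k" q] by (simp add: mult.assoc)
  have "(\<Sum>U\<in>signed_sets N l. q ^ shuffle_len N U * q ^ (if int N \<in> U then 2 * N else 0))
    = (q ^ (2 * N) + q ^ (2 * k + j + 1)) * shuffle_gf q (j + k) j + q ^ Suc j * shuffle_gf q (j + k) (Suc j)"
    using sum_shuffle_len_Suc[where q = q and N = "j + k" and l = j and z = "\<lambda>x y. q ^ (if x then 2 * N else 0)"]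
    by (simp add: N Suc)
  also have "\<dots> = q ^ Suc j * ((1 + q ^ (2 * k + j + 1)) * shuffle_gf q (j + k) j + q ^ Suc j * shuffle_gf q (j + k) (Suc j))"
  proof -
    have "(q ^ (2 * N) + q ^ (2 * k + j + 1)) * X + q ^ Suc j * Y
        = q ^ Suc j * ((1 + q ^ (2 * k + j + 1)) * X + q ^ Suc j * Y)"
      if "q ^ Suc j * (1 - q ^ (2 * k)) * X = q ^ Suc j * (1 - q ^ Suc j) * Y" for X Y
    proof -
      have p: "q ^ (2 * N) = q ^ Suc j * q ^ Suc j * q ^ (2 * k)" "q ^ (2 * k + j + 1) = q ^ Suc j * q ^ (2 * k)"
        by (simp_all add: N power_add power_mult power2_eq_square mult_ac)
      \<comment> \<open>With \<open>a = q ^ Suc j\<close> and \<open>b = q ^ (2 * k)\<close>, the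
        difference of the two sides is \<open>a\<close> times the difference in
        \<open>shuffle_gf_ratio\<close>.\<close>
      have "a * ((1 + a * b) * X + a * Y) - ((a * a * b + a * b) * X + a * Y)
          = a * (1 - b) * X - a * (1 - a) * Y" for a b :: 'a
        by (simp add: algebra_simps)
      then show ?thesis using that unfolding p by (metis eq_iff_diff_eq_0)
    qed
    then show ?thesis using r by blast
  qed
  also have "\<dots> = q ^ l * shuffle_gf q N l"
    using shuffle_gf_Suc[of q "j + k" j] by (simp add: N Suc)
  finally show ?thesis .
qed

text \<open>The case of a negative inserted letter: the descent at \<open>N\<close> fails exactly
  when \<open>- N\<close> lies in the suffix. The length gain is one more than the exponent here;
  that one is matched by \<open>neg_B\<close>.\<close>

lemma sum_shuffle_len_neg:
  fixes q :: "'a::comm_ring_1"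
  assumes "l \<le> N"
  shows "(\<Sum>U\<in>signed_sets N l. q ^ shuffle_len N U * q ^ (if - int N \<in> U then 0 else 2 * N))
       = q ^ (2 * (N - l) + l) * shuffle_gf q N l"
proof (cases l)
  case 0
  then show ?thesis using shuffle_gf_0[of q N] by (simp add: shuffle_gf_def flip: sum_distrib_right)
next
  case (Suc j)
  then obtain k where N: "N = Suc (j + k)" using assms by (metis add_Suc le_Suc_ex)
  have r: "q ^ (2 * N) * (1 - q ^ (2 * k)) * shuffle_gf q (j + k) j = q ^ (2 * N) * (1 - q ^ Suc j) * shuffle_gf q (j + k) (Suc j)"
    using shuffle_gf_ratio[of j "j + k" q] by (simp add: mult.assoc)
  have "(\<Sum>U\<in>signed_sets N l. q ^ shuffle_len N U * q ^ (if - int N \<in> U then 0 else 2 * N))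
    = (q ^ (2 * N) + q ^ (2 * k + j + 1)) * shuffle_gf q (j + k) j + q ^ Suc j * q ^ (2 * N) * shuffle_gf q (j + k) (Suc j)"
    using sum_shuffle_len_Suc[where q = q and N = "j + k" and l = j and z = "\<lambda>x y. q ^ (if y then 0 else 2 * N)"]
    by (simp add: N Suc algebra_simps)
  also have "\<dots> = q ^ (2 * k + Suc j) * ((1 + q ^ (2 * k + j + 1)) * shuffle_gf q (j + k) j + q ^ Suc j * shuffle_gf q (j + k) (Suc j))"
  proof -
    have "(q ^ (2 * N) + q ^ (2 * k + j + 1)) * X + q ^ Suc j * q ^ (2 * N) * Y
        = q ^ (2 * k + Suc j) * ((1 + q ^ (2 * k + j + 1)) * X + q ^ Suc j * Y)"
      if "q ^ (2 * N) * (1 - q ^ (2 * k)) * X = q ^ (2 * N) * (1 - q ^ Suc j) * Y" for X Y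
    proof -
      have p: "q ^ (2 * N) = q ^ Suc j * q ^ Suc j * q ^ (2 * k)" "q ^ (2 * k + j + 1) = q ^ Suc j * q ^ (2 * k)"
        "q ^ (2 * k + Suc j) = q ^ Suc j * q ^ (2 * k)"
        by (simp_all add: N power_add power_mult power2_eq_square mult_ac)
      \<comment> \<open>As in the positive case, now with the multiple
        \<open>a * a * b = q ^ (2 * N)\<close> of the ratio identity.\<close>
      have "(a * a * b + a * b) * X + a * (a * a * b) * Y - a * b * ((1 + a * b) * X + a * Y)
          = a * a * b * (1 - b) * X - a * a * b * (1 - a) * Y" for a b :: 'a
        by (simp add: algebra_simps)
      then show ?thesis using that unfolding p by (metis eq_iff_diff_eq_0)
    qed
    then show ?thesis using r by blast
  qed
  also have "\<dots> = q ^ (2 * (N - l) + l) * shuffle_gf q N l"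
    using shuffle_gf_Suc[of q "j + k" j] by (simp add: N Suc)
  finally show ?thesis .
qed

section \<open>Inserting the letter of largest absolute value\<close>

text \<open>If \<open>t\<close> is the window of \<open>\<sigma>\<inverse>\<close>, then \<open>pos t j\<close> is \<open>\<sigma> j\<close>; hence \<open>fmaj n (pos t)\<close> is \<open>fmaj n \<sigma>\<close>.\<close>

definition pos :: "int list \<Rightarrow> int \<Rightarrow> int" where
  "pos t j = (if j \<in> set t then 1 else - 1) * (int (length (takeWhile (\<lambda>y. \<bar>y\<bar> \<noteq> j) t)) + 1)"

definition ins :: "nat \<Rightarrow> nat \<Rightarrow> bool \<Rightarrow> int list \<Rightarrow> int list" where
  "ins N k e w = take k w @ (if e then - 1 - int N else 1 + int N) # drop k w"

lemma maj_A_Suc: "maj_A (Suc N) \<sigma> = maj_A N \<sigma> + (if \<sigma> (int N) > \<sigma> (int N + 1) then N else 0)"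
proof (cases "N = 0")
  case False
  have "{i \<in> {1..<Suc N}. \<sigma> (int i) > \<sigma> (int i + 1)} =
      {i \<in> {1..<N}. \<sigma> (int i) > \<sigma> (int i + 1)} \<union> (if \<sigma> (int N) > \<sigma> (int N + 1) then {N} else {})"
    using False by (auto simp: less_Suc_eq)
  then show ?thesis by (auto simp: maj_A_def)
qed (simp add: maj_A_def)

lemma neg_B_Suc: "neg_B (Suc N) \<sigma> = neg_B N \<sigma> + of_bool (\<sigma> (int N + 1) < 0)"
proof -
  have "{i \<in> {1..Suc N}. \<sigma> (int i) < 0} =
      {i \<in> {1..N}. \<sigma> (int i) < 0} \<union> (if \<sigma> (int N + 1) < 0 then {Suc N} else {})"
    by (auto simp: le_Suc_eq add.commute)
  then show ?thesis by (auto simp: neg_B_def)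
qed

lemma fmaj_cong:
  assumes "\<And>i. i \<in> {1..n} \<Longrightarrow> \<sigma> (int i) < 0 \<longleftrightarrow> \<tau> (int i) < 0"
    and "\<And>i. i \<in> {1..<n} \<Longrightarrow> \<sigma> (int i) > \<sigma> (int i + 1) \<longleftrightarrow> \<tau> (int i) > \<tau> (int i + 1)"
  shows "fmaj n \<sigma> = fmaj n \<tau>"
proof -
  have "{i \<in> {1..n}. \<sigma> (int i) < 0} = {i \<in> {1..n}. \<tau> (int i) < 0}"
    "{i \<in> {1..<n}. \<sigma> (int i) > \<sigma> (int i + 1)} = {i \<in> {1..<n}. \<tau> (int i) > \<tau> (int i + 1)}"
    using assms by auto
  then show ?thesis by (simp add: fmaj_def maj_A_def neg_B_def)
qed

lemma pos_split:
  assumes "distinct (map abs (A @ x # B))" "x \<noteq> 0"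
  shows "pos (A @ x # B) \<bar>x\<bar> = sgn x * (int (length A) + 1)"
proof -
  have "\<bar>x\<bar> \<notin> abs ` (set A \<union> set B)" using assms(1) by auto
  then have ne: "\<bar>y\<bar> \<noteq> \<bar>x\<bar>" if "y \<in> set A \<or> y \<in> set B" for y
    using that by (metis UnI1 UnI2 imageI)
  have "takeWhile (\<lambda>y. \<bar>y\<bar> \<noteq> \<bar>x\<bar>) (A @ x # B) = A @ takeWhile (\<lambda>y. \<bar>y\<bar> \<noteq> \<bar>x\<bar>) (x # B)"
    by (rule takeWhile_append2) (use ne in blast)
  moreover have "\<bar>x\<bar> \<in> set (A @ x # B) \<longleftrightarrow> 0 < x"
    using ne[of "\<bar>x\<bar>"] assms(2) by auto
  ultimately show ?thesis using assms(2) by (simp add: pos_def sgn_if)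
qed

text \<open>Here \<open>i\<close> is the zero-based index of \<open>x\<close> in
  \<open>A @ B\<close>; insertion moves only the letters of \<open>B\<close>. The exclusions let the
  side be recognized by membership in \<open>B\<close> alone.\<close>

lemma pos_append_cases:
  assumes "distinct (map abs (A @ m # B))" "x \<in> set (A @ B)" "x \<noteq> 0"
  obtains (left) i where "i < length A" "x \<in> set A" "x \<notin> set B" "- x \<notin> set B"
      "pos (A @ B) \<bar>x\<bar> = sgn x * (int i + 1)" "pos (A @ m # B) \<bar>x\<bar> = sgn x * (int i + 1)"
  | (right) i where "length A \<le> i" "x \<in> set B" "- x \<notin> set B"
      "pos (A @ B) \<bar>x\<bar> = sgn x * (int i + 1)" "pos (A @ m # B) \<bar>x\<bar> = sgn x * (int i + 2)"
proof (cases "x \<in> set A")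
  case True
  then obtain X Y where A: "A = X @ x # Y" by (auto simp: in_set_conv_decomp)
  have "pos (A @ B) \<bar>x\<bar> = sgn x * (int (length X) + 1)"
    using pos_split[of X x "Y @ B"] assms by (simp add: A)
  moreover have "pos (A @ m # B) \<bar>x\<bar> = sgn x * (int (length X) + 1)"
    using pos_split[of X x "Y @ m # B"] assms by (simp add: A)
  moreover have "\<bar>x\<bar> \<notin> abs ` set B" using assms(1) by (simp add: A)
  then have "x \<notin> set B" "- x \<notin> set B"
    by (metis imageI, metis imageI abs_minus_cancel)
  ultimately show ?thesis using left[of "length X"] True A by simp
next
  case False
  then have x: "x \<in> set B" using assms by auto
  then obtain X Y where B: "B = X @ x # Y" by (auto simp: in_set_conv_decomp)
  have "pos (A @ B) \<bar>x\<bar> = sgn x * (int (length (A @ X)) + 1)"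
    using pos_split[of "A @ X" x Y] assms by (simp add: B)
  moreover have "pos (A @ m # B) \<bar>x\<bar> = sgn x * (int (length (A @ m # X)) + 1)"
    using pos_split[of "A @ m # X" x Y] assms by (simp add: B)
  moreover have "\<bar>x\<bar> \<notin> abs ` (set X \<union> set Y)" using assms(1) by (auto simp: B)
  then have "- x \<notin> set X \<union> set Y" by (metis imageI abs_minus_cancel)
  then have "- x \<notin> set B" using assms(3) by (auto simp: B)
  ultimately show ?thesis using right[of "length (A @ X)"] x by (simp add: algebra_simps)
qed

lemma signed_words_bounds:
  assumes "w \<in> signed_words {1..int N}" "x \<in> set w"
  shows "\<bar>x\<bar> < 1 + int N" "x \<noteq> 0"
proof -
  have "\<bar>x\<bar> \<in> {1..int N}" using signed_wordsD(2)[OF assms(1)] assms(2) by blast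
  then show "\<bar>x\<bar> < 1 + int N" "x \<noteq> 0" by auto
qed

lemma signed_words_split_bounds:
  assumes "w \<in> signed_words {1..int N}" "x \<in> set (take k w) \<union> set (drop k w)"
  shows "\<bar>x\<bar> < 1 + int N"
  using assms by (meson UnE in_set_takeD in_set_dropD signed_words_bounds(1))

lemma ins_in_signed_words:
  assumes w: "w \<in> signed_words {1..int N}"
  shows "ins N k e w \<in> signed_words {1..int (Suc N)}"
proof -
  define m where "m = (if e then - 1 - int N else 1 + int N)"
  have m: "\<bar>m\<bar> = 1 + int N" by (simp add: m_def)
  have "set (take k w) \<union> set (drop k w) = set w"
    by (metis append_take_drop_id set_append)
  then have "set (ins N k e w) = insert m (set w)" by (auto simp: ins_def m_def)
  then have "abs ` set (ins N k e w) = insert \<bar>m\<bar> (abs ` set w)" by simp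
  also have "\<dots> = {1..int (Suc N)}"
    unfolding signed_wordsD(2)[OF w] m by auto
  finally have set: "abs ` set (ins N k e w) = {1..int (Suc N)}" .
  have "mset (map abs (ins N k e w)) = mset (\<bar>m\<bar> # map abs (take k w @ drop k w))"
    unfolding ins_def m_def by (simp del: append_take_drop_id)
  also have "\<dots> = mset (\<bar>m\<bar> # map abs w)" by simp
  finally have "distinct (map abs (ins N k e w)) \<longleftrightarrow> distinct (\<bar>m\<bar> # map abs w)"
    by (rule mset_eq_imp_distinct_iff)
  moreover have "\<bar>m\<bar> \<notin> set (map abs w)"
    using signed_wordsD(2)[OF w] m by auto
  ultimately show ?thesis
    using signed_wordsD(1)[OF w] set by (simp add: signed_words_def permutations_of_set_def)
qed

text \<open>The inverse records the place and sign of the letter of absolute value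
  \<open>N + 1\<close> and filters it out.\<close>

lemma ins_bij:
  "bij_betw (\<lambda>((k, e), w). ins N k e w) (({..N} \<times> UNIV) \<times> signed_words {1..int N})
     (signed_words {1..int (Suc N)})"
proof (rule bij_betw_byWitness[where f' = "\<lambda>t.
    ((length (takeWhile (\<lambda>y. \<bar>y\<bar> \<noteq> 1 + int N) t), - 1 - int N \<in> set t), filter (\<lambda>y. \<bar>y\<bar> \<noteq> 1 + int N) t)"])
  show "\<forall>p\<in>({..N} \<times> UNIV) \<times> signed_words {1..int N}.
      (\<lambda>t. ((length (takeWhile (\<lambda>y. \<bar>y\<bar> \<noteq> 1 + int N) t), - 1 - int N \<in> set t),
        filter (\<lambda>y. \<bar>y\<bar> \<noteq> 1 + int N) t)) ((\<lambda>((k, e), w). ins N k e w) p) = p"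
  proof
    fix p assume "p \<in> ({..N} \<times> (UNIV :: bool set)) \<times> signed_words {1..int N}"
    then obtain k e w where p: "p = ((k, e), w)" and kw: "k \<in> {..N}" "w \<in> signed_words {1..int N}"
      by auto
    let ?m = "if e then - 1 - int N else 1 + int N"
    have P: "\<bar>x\<bar> \<noteq> 1 + int N" if "x \<in> set (take k w) \<or> x \<in> set (drop k w)" for x
      using signed_words_split_bounds[OF kw(2), of x k] that by auto
    have t: "ins N k e w = take k w @ ?m # drop k w" by (simp add: ins_def)
    have "takeWhile (\<lambda>y. \<bar>y\<bar> \<noteq> 1 + int N) (ins N k e w) = take k w"
      unfolding t using P by (subst takeWhile_append2) auto
    moreover have "filter (\<lambda>y. \<bar>y\<bar> \<noteq> 1 + int N) (ins N k e w) = take k w @ drop k w"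
      unfolding t using P by (auto simp del: append_take_drop_id simp: filter_id_conv)
    moreover have "- 1 - int N \<in> set (ins N k e w) \<longleftrightarrow> e"
      unfolding t using P[of "- 1 - int N"] by auto
    ultimately show "(\<lambda>t. ((length (takeWhile (\<lambda>y. \<bar>y\<bar> \<noteq> 1 + int N) t), - 1 - int N \<in> set t),
        filter (\<lambda>y. \<bar>y\<bar> \<noteq> 1 + int N) t)) ((\<lambda>((k, e), w). ins N k e w) p) = p"
      using kw signed_wordsD(3)[OF kw(2)] by (simp add: p)
  qed
  have split: "\<exists>A e B. t = A @ (if e then - 1 - int N else 1 + int N) # B \<and> (- 1 - int N \<in> set t \<longleftrightarrow> e)
      \<and> takeWhile (\<lambda>y. \<bar>y\<bar> \<noteq> 1 + int N) t = A \<and> filter (\<lambda>y. \<bar>y\<bar> \<noteq> 1 + int N) t = A @ B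
      \<and> length A \<le> N \<and> A @ B \<in> signed_words {1..int N}"
    if t: "t \<in> signed_words {1..int (Suc N)}" for t
  proof -
    note D = signed_wordsD[OF t]
    have "1 + int N \<in> abs ` set t" using D(2) by auto
    then obtain x where x: "x \<in> set t" "\<bar>x\<bar> = 1 + int N" by auto
    then obtain A B where AB: "t = A @ x # B" by (auto simp: in_set_conv_decomp)
    have ne: "\<bar>y\<bar> \<noteq> 1 + int N" if "y \<in> set A \<or> y \<in> set B" for y
    proof -
      have "\<bar>x\<bar> \<notin> abs ` set A \<union> abs ` set B" using D(1) by (simp add: AB)
      then show ?thesis using x(2) that by (metis UnI1 UnI2 imageI)
    qed
    have xe: "x = (if x < 0 then - 1 - int N else 1 + int N)" using x(2) by auto
    have "abs ` set (A @ B) = abs ` set t - {1 + int N}"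
      using ne x(2) by (auto simp: AB)
    also have "\<dots> = {1..int N}" unfolding D(2) by auto
    finally have "A @ B \<in> signed_words {1..int N}"
      using D(1) by (auto simp: signed_words_def permutations_of_set_def AB)
    moreover have "length A \<le> N" using signed_wordsD(3)[OF calculation] by simp
    moreover have "- 1 - int N \<in> set t \<longleftrightarrow> x < 0"
      using ne[of "- 1 - int N"] xe by (auto simp: AB)
    moreover have "takeWhile (\<lambda>y. \<bar>y\<bar> \<noteq> 1 + int N) t = A"
      unfolding AB using ne x(2) by (subst takeWhile_append2) auto
    moreover have "filter (\<lambda>y. \<bar>y\<bar> \<noteq> 1 + int N) t = A @ B"
      unfolding AB using ne x(2) by (auto simp: filter_id_conv)
    moreover have "t = A @ (if x < 0 then - 1 - int N else 1 + int N) # B"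
      unfolding xe[symmetric] by (rule AB)
    ultimately show ?thesis by blast
  qed
  show "\<forall>t\<in>signed_words {1..int (Suc N)}. (\<lambda>((k, e), w). ins N k e w)
      ((length (takeWhile (\<lambda>y. \<bar>y\<bar> \<noteq> 1 + int N) t), - 1 - int N \<in> set t), filter (\<lambda>y. \<bar>y\<bar> \<noteq> 1 + int N) t) = t"
  proof
    fix t assume t: "t \<in> signed_words {1..int (Suc N)}"
    from split[OF t] obtain A e B where *: "t = A @ (if e then - 1 - int N else 1 + int N) # B"
      "- 1 - int N \<in> set t \<longleftrightarrow> e" "takeWhile (\<lambda>y. \<bar>y\<bar> \<noteq> 1 + int N) t = A"
      "filter (\<lambda>y. \<bar>y\<bar> \<noteq> 1 + int N) t = A @ B" by blast
    show "(\<lambda>((k, e), w). ins N k e w)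
      ((length (takeWhile (\<lambda>y. \<bar>y\<bar> \<noteq> 1 + int N) t), - 1 - int N \<in> set t), filter (\<lambda>y. \<bar>y\<bar> \<noteq> 1 + int N) t) = t"
      unfolding *(2-4) by (simp add: ins_def *(1))
  qed
  show "(\<lambda>((k, e), w). ins N k e w) ` (({..N} \<times> UNIV) \<times> signed_words {1..int N}) \<subseteq> signed_words {1..int (Suc N)}"
    using ins_in_signed_words by auto
  show "(\<lambda>t. ((length (takeWhile (\<lambda>y. \<bar>y\<bar> \<noteq> 1 + int N) t), - 1 - int N \<in> set t),
        filter (\<lambda>y. \<bar>y\<bar> \<noteq> 1 + int N) t)) ` signed_words {1..int (Suc N)}
      \<subseteq> ({..N} \<times> UNIV) \<times> signed_words {1..int N}"
    using split by (fastforce simp del: length_takeWhile_le)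
qed

text \<open>The inserted letter is smaller than all others if negative and larger if positive, which
  decides both comparisons with its neighbours. The old comparison across the cut
  disappears.\<close>

lemma dsc_ins:
  assumes w: "w \<in> signed_words {1..int N}" and k: "k \<le> N"
  shows "dsc (0 # ins N k e w)
       = dsc (0 # take k w) @ e # (if k < N then (\<not> e) # dsc (drop k w) else [])"
proof -
  define A B where "A = take k w" and "B = drop k w"
  let ?m = "if e then - 1 - int N else 1 + int N"
  have bA: "\<bar>x\<bar> < 1 + int N" if "x \<in> set A" for x
    using signed_words_split_bounds[OF w] that unfolding A_def by blast
  have bB: "\<bar>x\<bar> < 1 + int N" if "x \<in> set B" for x
    using signed_words_split_bounds[OF w] that unfolding B_def by blast
  have "length w = N" using signed_wordsD(3)[OF w] by simp
  then have B: "B = [] \<longleftrightarrow> \<not> k < N" by (auto simp: B_def)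
  have "last (0 # A) > ?m \<longleftrightarrow> e"
    using bA[of "last A"] by (cases "A = []") (auto simp: abs_if split: if_splits)
  moreover have "dsc (?m # B) = (if k < N then (\<not> e) # dsc B else [])"
    using B bB[of "hd B"] by (cases B) (auto simp: abs_if split: if_splits)
  ultimately show ?thesis
    unfolding ins_def A_def[symmetric] B_def[symmetric]
    using dsc_append[of "0 # A" ?m B] dsc_snoc[of "0 # A" ?m] by simp
qed

text \<open>Entry \<open>k\<close> of \<open>dsc (0 # w)\<close> compares the letters at the cut and
  is skipped. Both parts become functions of \<open>dsc (0 # w)\<close>, as the induction hypothesis
  requires.\<close>

lemma dsc_take_drop:
  assumes "k \<le> length w"
  shows "dsc (0 # take k w) = take k (dsc (0 # w))" "dsc (drop k w) = drop (Suc k) (dsc (0 # w))"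
proof -
  define A B where "A = take k w" and "B = drop k w"
  have w: "w = A @ B" and lA: "length A = k" using assms by (auto simp: A_def B_def)
  have "dsc (0 # A) = take k (dsc (0 # w)) \<and> dsc B = drop (Suc k) (dsc (0 # w))"
  proof (cases B)
    case Nil
    then show ?thesis by (simp add: w lA)
  next
    case (Cons b bs)
    have "dsc (0 # w) = dsc (0 # A) @ [last (0 # A) > b] @ dsc (b # bs)"
      using dsc_append[of "0 # A" b bs] dsc_snoc[of "0 # A" b] by (simp add: w Cons)
    then show ?thesis using lA by (simp add: Cons)
  qed
  then show "dsc (0 # take k w) = take k (dsc (0 # w))" "dsc (drop k w) = drop (Suc k) (dsc (0 # w))"
    by (simp_all add: A_def B_def)
qed

lemma len_ins:
  assumes w: "w \<in> signed_words {1..int N}" and k: "k \<le> N"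
  shows "len (ins N k e w) = len w + (if e then 2 * k + (N - k) + 1 else N - k)"
proof -
  have lw: "length w = N" using signed_wordsD(3)[OF w] by simp
  note b = signed_words_split_bounds[OF w, of _ k]
  show ?thesis
    using len_insert_max[of "take k w" "drop k w" "1 + int N"]
      len_insert_min[of "take k w" "drop k w" "1 + int N"] b k lw
    by (simp add: ins_def)
qed

lemma pos_ins_new:
  assumes w: "w \<in> signed_words {1..int N}" and k: "k \<le> N"
  shows "pos (ins N k e w) (1 + int N) = (if e then - 1 - int k else 1 + int k)"
proof -
  have "distinct (map abs (ins N k e w))"
    by (rule signed_wordsD(1)[OF ins_in_signed_words[OF w]])
  then show ?thesis
    using pos_split[of "take k w" "if e then - 1 - int N else 1 + int N" "drop k w"]
      signed_wordsD(3)[OF w] k by (cases e) (auto simp: ins_def algebra_simps)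
qed

text \<open>
  With \<open>p\<close> the signed position of \<open>\<plusminus>N\<close> in \<open>w\<close>, this says that the last two letters
  \<open>\<sigma> N\<close>, \<open>\<sigma> (N + 1)\<close> belonging to \<open>ins N k e w\<close> form a descent.
\<close>

definition jumps :: "nat \<Rightarrow> bool \<Rightarrow> int \<Rightarrow> bool" where
  "jumps k e p \<longleftrightarrow> (if e then p \<ge> - int k else p > int k)"

text \<open>Signed positions beyond the cut move one place away from zero; the sign of
  \<open>p\<close> tells whether \<open>j\<close> or \<open>- j\<close> is the letter there.\<close>

lemma pos_ins_old:
  assumes w: "w \<in> signed_words {1..int N}" and k: "k \<le> N" and "j \<in> {1..int N}"
  defines "p \<equiv> pos w j"
  shows "pos (ins N k e w) j = (if \<bar>p\<bar> \<le> int k then p else p + sgn p)"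
    "p > int k \<longleftrightarrow> j \<in> set (drop k w)" "p \<ge> - int k \<longleftrightarrow> - j \<notin> set (drop k w)" "p \<noteq> 0"
proof -
  let ?m = "if e then - 1 - int N else 1 + int N"
  have dist: "distinct (map abs (take k w @ ?m # drop k w))"
    using signed_wordsD(1)[OF ins_in_signed_words[OF w, of k e]] unfolding ins_def .
  have lk: "length (take k w) = k" using signed_wordsD(3)[OF w] k by simp
  obtain x where x: "x \<in> set w" "\<bar>x\<bar> = j" using signed_wordsD(2)[OF w] assms(3) by (metis imageE)
  have x0: "x \<noteq> 0" using x assms(3) by auto
  have xs: "x \<in> set (take k w @ drop k w)" using x by simp
  have "pos (ins N k e w) j = (if \<bar>p\<bar> \<le> int k then p else p + sgn p) \<and>
    (p > int k \<longleftrightarrow> j \<in> set (drop k w)) \<and> (p \<ge> - int k \<longleftrightarrow> - j \<notin> set (drop k w)) \<and> p \<noteq> 0"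
    using dist xs x0
  proof (cases rule: pos_append_cases)
    case (left i)
    have "j \<notin> set (drop k w)" "- j \<notin> set (drop k w)" using left x(2) by (auto simp: abs_if split: if_splits)
    then show ?thesis using left x x0 lk by (cases "0 < x") (auto simp: ins_def p_def)
  next
    case (right i)
    have "j \<in> set (drop k w) \<longleftrightarrow> 0 < x" "- j \<in> set (drop k w) \<longleftrightarrow> x < 0"
      using right x(2) x0 by (auto simp: abs_if split: if_splits)
    then show ?thesis using right x x0 lk by (cases "0 < x") (auto simp: ins_def p_def)
  qed
  then show "pos (ins N k e w) j = (if \<bar>p\<bar> \<le> int k then p else p + sgn p)"
    "p > int k \<longleftrightarrow> j \<in> set (drop k w)" "p \<ge> - int k \<longleftrightarrow> - j \<notin> set (drop k w)" "p \<noteq> 0"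
    by auto
qed

text \<open>The shift \<open>s\<close> of the old positions is strictly increasing and preserves
  signs, so the old descents and signs persist. New are the possible descent at \<open>N\<close>,
  worth \<open>2 * N\<close>, and the sign at \<open>N + 1\<close>.\<close>

lemma fmaj_pos_ins:
  assumes w: "w \<in> signed_words {1..int N}" and k: "k \<le> N"
  shows "fmaj (Suc N) (pos (ins N k e w))
       = fmaj N (pos w) + (if jumps k e (pos w (int N)) then 2 * N else 0) + of_bool e"
proof -
  let ?t = "ins N k e w"
  define s where "s p = (if \<bar>p\<bar> \<le> int k then p else p + sgn p)" for p
  have t: "pos ?t (int i) = s (pos w (int i))" if "i \<in> {1..N}" for i
    using pos_ins_old(1)[OF w k, of "int i" e] that by (simp add: s_def)
  have neg: "s p < 0 \<longleftrightarrow> p < 0" and less: "s p < s p' \<longleftrightarrow> p < p'" for p p'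
    by (auto simp: s_def sgn_if)
  have "fmaj N (pos ?t) = fmaj N (pos w)"
  proof (rule fmaj_cong)
    fix i assume "i \<in> {1..<N}"
    then show "pos ?t (int i) > pos ?t (int i + 1) \<longleftrightarrow> pos w (int i) > pos w (int i + 1)"
      using t[of i] t[of "Suc i"] less by (simp add: add.commute)
  qed (simp add: t neg)
  moreover have "pos ?t (int N) > pos ?t (int N + 1) \<longleftrightarrow> jumps k e (pos w (int N))" if "N \<noteq> 0"
    using t[of N] pos_ins_new[OF w k, of e] that
    by (auto simp: jumps_def s_def sgn_if add.commute)
  ultimately show ?thesis
    using pos_ins_new[OF w k, of e]
    by (cases "N = 0") (auto simp: fmaj_def maj_A_Suc neg_B_Suc add.commute)
qed

text \<open>\<open>jumps\<close> depends on \<open>w\<close> only through the letters of the suffix,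
  so both sums split with the same \<open>word_factor\<close> and only the shuffle sums are
  compared.\<close>

lemma sum_jumps:
  fixes q :: "'a::comm_ring_1"
  assumes k: "k \<le> N"
  shows "(\<Sum>w\<in>signed_words {1..int N}. q ^ len w * q ^ (if jumps k e (pos w (int N)) then 2 * N else 0)
            * \<phi> (dsc (0 # take k w)) (dsc (drop k w)))
       = q ^ (if e then 2 * k + (N - k) else N - k)
         * (\<Sum>w\<in>signed_words {1..int N}. q ^ len w * \<phi> (dsc (0 # take k w)) (dsc (drop k w)))"
proof -
  define z where "z U = q ^ (if e then (if - int N \<in> U then 0 else 2 * N) else if int N \<in> U then 2 * N else 0)" for U
  have "(\<Sum>w\<in>signed_words {1..int N}. q ^ len w * q ^ (if jumps k e (pos w (int N)) then 2 * N else 0)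
            * \<phi> (dsc (0 # take k w)) (dsc (drop k w)))
      = (\<Sum>w\<in>signed_words {1..int N}. q ^ len w * z (set (drop k w)) * \<phi> (dsc (0 # take k w)) (dsc (drop k w)))"
  proof (intro sum.cong refl)
    fix w assume w: "w \<in> signed_words {1..int N}"
    have "q ^ (if jumps k e (pos w (int N)) then 2 * N else 0) = z (set (drop k w))"
      using pos_ins_old(2,3)[OF w k, of "int N"] by (cases "N = 0") (auto simp: z_def jumps_def)
    then show "q ^ len w * q ^ (if jumps k e (pos w (int N)) then 2 * N else 0) * \<phi> (dsc (0 # take k w)) (dsc (drop k w))
      = q ^ len w * z (set (drop k w)) * \<phi> (dsc (0 # take k w)) (dsc (drop k w))" by simp
  qed
  also have "\<dots> = (\<Sum>U\<in>signed_sets N (N - k). q ^ shuffle_len N U * z U) * word_factor q k (N - k) \<phi>"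
    by (rule sum_signed_words_split[OF k])
  also have "(\<Sum>U\<in>signed_sets N (N - k). q ^ shuffle_len N U * z U)
      = q ^ (if e then 2 * k + (N - k) else N - k) * shuffle_gf q N (N - k)"
    using sum_shuffle_len_pos[of "N - k" N q] sum_shuffle_len_neg[of "N - k" N q] k
    by (cases e) (simp_all add: z_def)
  also have "\<dots> * word_factor q k (N - k) \<phi> =
      q ^ (if e then 2 * k + (N - k) else N - k) * (shuffle_gf q N (N - k) * word_factor q k (N - k) \<phi>)"
    by (simp add: mult.assoc)
  also have "shuffle_gf q N (N - k) * word_factor q k (N - k) \<phi>
      = (\<Sum>w\<in>signed_words {1..int N}. q ^ len w * \<phi> (dsc (0 # take k w)) (dsc (drop k w)))"
    using sum_signed_words_split[OF k, of q "\<lambda>_. 1" \<phi>] by (simp add: shuffle_gf_def)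
  finally show ?thesis .
qed

text \<open>The second argument of \<open>g\<close> is there for the induction: whether the next
  insertion creates a descent depends on this position, and an arbitrary \<open>g\<close> can absorb
  the resulting weight.\<close>

theorem sum_fmaj_eq_sum_len:
  fixes q :: "'a::comm_ring_1"
  shows "(\<Sum>t\<in>signed_words {1..int n}. q ^ fmaj n (pos t) * g (dsc (0 # t)) (pos t (int n)))
       = (\<Sum>t\<in>signed_words {1..int n}. q ^ len t * g (dsc (0 # t)) (pos t (int n)))"
proof (induction n arbitrary: g)
  case 0
  have "signed_words {1..int 0} = {[]}" by (auto simp: signed_words_def)
  then show ?case by (simp add: fmaj_def maj_A_def neg_B_def)
next
  case (Suc N)
  let ?W = "signed_words {1..int N}"
  define h where "h k e a b = g (a @ e # (if k < N then (\<not> e) # b else [])) (if e then - 1 - int k else 1 + int k)"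
    for k e a b
  have g: "g (dsc (0 # ins N k e w)) (pos (ins N k e w) (int (Suc N))) = h k e (dsc (0 # take k w)) (dsc (drop k w))"
    if "k \<le> N" "w \<in> ?W" for k e w
    using dsc_ins[OF that(2,1), of e] pos_ins_new[OF that(2,1), of e] by (simp add: h_def add.commute)
  have reindex: "(\<Sum>t\<in>signed_words {1..int (Suc N)}. f t) = (\<Sum>(k, e)\<in>{..N} \<times> UNIV. \<Sum>w\<in>?W. f (ins N k e w))"
    for f :: "int list \<Rightarrow> 'a"
    unfolding sum.reindex_bij_betw[OF ins_bij, symmetric] case_prod_unfold
      sum.cartesian_product[of "\<lambda>x w. f (ins N (fst x) (snd x) w)"] ..
  have eq: "(\<Sum>w\<in>?W. q ^ fmaj (Suc N) (pos (ins N k e w)) * g (dsc (0 # ins N k e w)) (pos (ins N k e w) (int (Suc N))))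
     = (\<Sum>w\<in>?W. q ^ len (ins N k e w) * g (dsc (0 # ins N k e w)) (pos (ins N k e w) (int (Suc N))))"
    if k: "k \<le> N" for k e
  proof -
    \<comment> \<open>The test function for the induction hypothesis: the jump weight times the
      value of \<open>g\<close> after insertion.\<close>
    define G where "G d p = q ^ (if jumps k e p then 2 * N else 0) * h k e (take k d) (drop (Suc k) d)" for d p
    have G: "G (dsc (0 # w)) p = q ^ (if jumps k e p then 2 * N else 0) * h k e (dsc (0 # take k w)) (dsc (drop k w))"
      if "w \<in> ?W" for w p
      using dsc_take_drop[of k w] signed_wordsD(3)[OF that] k by (simp add: G_def)
    have "(\<Sum>w\<in>?W. q ^ fmaj (Suc N) (pos (ins N k e w)) * g (dsc (0 # ins N k e w)) (pos (ins N k e w) (int (Suc N))))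
      = q ^ of_bool e * (\<Sum>w\<in>?W. q ^ fmaj N (pos w) * G (dsc (0 # w)) (pos w (int N)))"
      unfolding sum_distrib_left
      by (intro sum.cong refl) (simp add: g[OF k] G fmaj_pos_ins[OF _ k] power_add mult_ac del: of_nat_Suc)
    also have "\<dots> = q ^ of_bool e * (\<Sum>w\<in>?W. q ^ len w * G (dsc (0 # w)) (pos w (int N)))"
      by (simp only: Suc.IH)
    \<comment> \<open>The jump weight becomes a constant power of \<open>q\<close>; together with
      \<open>q ^ of_bool e\<close> it is exactly the gain in \<open>len_ins\<close>.\<close>
    also have "(\<Sum>w\<in>?W. q ^ len w * G (dsc (0 # w)) (pos w (int N)))
      = q ^ (if e then 2 * k + (N - k) else N - k) * (\<Sum>w\<in>?W. q ^ len w * h k e (dsc (0 # take k w)) (dsc (drop k w)))"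
      unfolding sum_jumps[OF k, symmetric]
      by (intro sum.cong refl) (simp add: G mult.assoc)
    also have "q ^ of_bool e * \<dots>
      = (\<Sum>w\<in>?W. q ^ len (ins N k e w) * g (dsc (0 # ins N k e w)) (pos (ins N k e w) (int (Suc N))))"
      unfolding sum_distrib_left
      by (intro sum.cong refl) (auto simp add: g[OF k] len_ins[OF _ k] power_add mult_ac simp del: of_nat_Suc)
    finally show ?thesis .
  qed
  show ?case unfolding reindex by (intro sum.cong refl) (auto intro: eq simp del: of_nat_Suc)
qed

section \<open>The hyperoctahedral group\<close>

definition window :: "nat \<Rightarrow> (int \<Rightarrow> int) \<Rightarrow> int list" where
  "window n \<sigma> = map \<sigma> [1..int n]"

lemma mem_pm_set: "a \<in> pm_set n \<longleftrightarrow> a \<noteq> 0 \<and> \<bar>a\<bar> \<le> int n"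
  by (auto simp: pm_set_def)

lemma hyperoctD:
  assumes "\<sigma> \<in> hyperoct n"
  shows "\<sigma> permutes pm_set n" "bij \<sigma>" "\<sigma> 0 = 0" "\<sigma> (- a) = - \<sigma> a" "\<sigma> a = 0 \<longleftrightarrow> a = 0"
    "\<sigma> a = \<sigma> b \<longleftrightarrow> a = b"
proof -
  show p: "\<sigma> permutes pm_set n" using assms by (simp add: hyperoct_def)
  then show b: "bij \<sigma>" by (rule permutes_bij)
  show 0: "\<sigma> 0 = 0" by (rule permutes_not_in[OF p]) (simp add: mem_pm_set)
  show "\<sigma> (- a) = - \<sigma> a"
  proof (cases "a \<in> pm_set n")
    case True then show ?thesis using assms by (simp add: hyperoct_def)
  next
    case False
    then have "- a \<notin> pm_set n" by (simp add: mem_pm_set)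
    then show ?thesis using False by (simp add: permutes_not_in[OF p])
  qed
  show inj: "\<sigma> a = \<sigma> b \<longleftrightarrow> a = b" for a b using bij_is_inj[OF b] by (rule inj_eq)
  show "\<sigma> a = 0 \<longleftrightarrow> a = 0" using inj[of a 0] 0 by simp
qed

lemma hyperoct_id: "id \<in> hyperoct n"
  by (simp add: hyperoct_def permutes_id)

lemma hyperoct_comp:
  assumes "\<sigma> \<in> hyperoct n" "\<tau> \<in> hyperoct n"
  shows "\<sigma> \<circ> \<tau> \<in> hyperoct n"
  using permutes_compose[OF hyperoctD(1)[OF assms(2)] hyperoctD(1)[OF assms(1)]]
  by (simp add: hyperoct_def hyperoctD(4)[OF assms(1)] hyperoctD(4)[OF assms(2)])

lemma hyperoct_inv:
  assumes "\<sigma> \<in> hyperoct n"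
  shows "inv \<sigma> \<in> hyperoct n"
proof -
  have "inv \<sigma> (- a) = - inv \<sigma> a" for a
    using hyperoctD(2,4)[OF assms] by (metis bij_inv_eq_iff)
  then show ?thesis using permutes_inv[OF hyperoctD(1)[OF assms]] by (simp add: hyperoct_def)
qed

lemma hyperoct_gen_B:
  assumes "i < n"
  shows "gen_B i \<in> hyperoct n"
proof (cases "i = 0")
  case True
  have "transpose 1 (- 1) permutes pm_set n"
    by (rule permutes_swap_id) (use assms in \<open>auto simp: mem_pm_set\<close>)
  then show ?thesis using True by (auto simp: hyperoct_def gen_B_def transpose_def)
next
  case False
  have "transpose (int i) (int i + 1) \<circ> transpose (- int i) (- (int i + 1)) permutes pm_set n"
    by (intro permutes_compose permutes_swap_id) (use assms False in \<open>auto simp: mem_pm_set\<close>)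
  then show ?thesis using False by (auto simp: hyperoct_def gen_B_def transpose_def)
qed

lemma gen_B_gen_B: "gen_B i \<circ> gen_B i = id"
  by (auto simp: gen_B_def transpose_def fun_eq_iff)

section \<open>Coxeter length and descents read off the window\<close>

lemma len_neg_Cons: "0 < x \<Longrightarrow> len (- x # xs) = Suc (len (x # xs))"
  by (simp add: cross_def [abs_def] add.commute)

text \<open>The condition \<open>y < - x\<close> is symmetric in \<open>x\<close> and
  \<open>y\<close>, so swapping neighbours affects only their direct comparison.\<close>

lemma len_swap: "y < x \<Longrightarrow> len (xs @ x # y # ys) = Suc (len (xs @ y # x # ys))"
  by (auto simp: len_append cross_def sum_list_addf)

lemma window_comp_gen_B_0:
  assumes "\<sigma> \<in> hyperoct n" "0 < n"
  shows "window n \<sigma> = \<sigma> 1 # map \<sigma> [2..int n]"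
    "window n (\<sigma> \<circ> gen_B 0) = - \<sigma> 1 # map \<sigma> [2..int n]"
  using assms hyperoctD(4)[OF assms(1), of 1]
  by (auto simp: window_def upto_rec1 gen_B_def transpose_def)

lemma window_comp_gen_B:
  assumes "0 < i" "i < n"
  shows "window n \<sigma> = map \<sigma> [1..int i - 1] @ \<sigma> (int i) # \<sigma> (int i + 1) # map \<sigma> [int i + 2..int n]"
    "window n (\<sigma> \<circ> gen_B i) = map \<sigma> [1..int i - 1] @ \<sigma> (int i + 1) # \<sigma> (int i) # map \<sigma> [int i + 2..int n]"
proof -
  have "[1..int n] = [1..int i - 1] @ [int i..int n]"
    using assms by (intro upto_split1) auto
  also have "[int i..int n] = int i # (int i + 1) # [int i + 2..int n]"
    using assms by (simp add: upto_rec1 add.commute)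
  finally have *: "[1..int n] = [1..int i - 1] @ int i # (int i + 1) # [int i + 2..int n]" .
  show "window n \<sigma> = map \<sigma> [1..int i - 1] @ \<sigma> (int i) # \<sigma> (int i + 1) # map \<sigma> [int i + 2..int n]"
    by (simp add: window_def *)
  show "window n (\<sigma> \<circ> gen_B i) = map \<sigma> [1..int i - 1] @ \<sigma> (int i + 1) # \<sigma> (int i) # map \<sigma> [int i + 2..int n]"
    using assms by (auto simp: window_def * gen_B_def transpose_def)
qed

text \<open>As \<open>\<sigma> 0 = 0\<close>, one comparison covers both kinds of generators, the
  sign change of the first letter and the swap of neighbours.\<close>

lemma len_comp_gen_B:
  assumes "\<sigma> \<in> hyperoct n" "i < n"
  shows "if \<sigma> (int i) > \<sigma> (int i + 1)
    then len (window n \<sigma>) = Suc (len (window n (\<sigma> \<circ> gen_B i)))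
    else len (window n (\<sigma> \<circ> gen_B i)) = Suc (len (window n \<sigma>))"
proof (cases "i = 0")
  case True
  then show ?thesis
    using window_comp_gen_B_0[OF assms(1)] assms(2) hyperoctD(3)[OF assms(1)] hyperoctD(5)[OF assms(1), of 1]
      len_neg_Cons[of "\<sigma> 1" "map \<sigma> [2..int n]"] len_neg_Cons[of "- \<sigma> 1" "map \<sigma> [2..int n]"]
    by auto
next
  case False
  have "\<sigma> (int i) \<noteq> \<sigma> (int i + 1)" using hyperoctD(6)[OF assms(1)] by simp
  then show ?thesis
    using window_comp_gen_B[of i n \<sigma>] False assms(2) by (simp add: len_swap)
qed

text \<open>Without descents the values increase strictly from \<open>\<sigma> 0 = 0\<close> and
  stay at most \<open>n\<close>, which leaves no room for gaps.\<close>

lemma hyperoct_eq_id: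
  assumes "\<sigma> \<in> hyperoct n" "\<And>i. i < n \<Longrightarrow> \<sigma> (int i) \<le> \<sigma> (int i + 1)"
  shows "\<sigma> = id"
proof -
  note D = hyperoctD[OF assms(1)]
  have less: "\<sigma> (int i) < \<sigma> (int i + 1)" if "i < n" for i
    using assms(2)[OF that] D(6)[of "int i" "int i + 1"] by simp
  have lower: "int j \<le> \<sigma> (int j)" if "j \<le> n" for j
    using that
  proof (induction j)
    case (Suc j)
    then show ?case using less[of j] by (simp add: add.commute)
  qed (simp add: D)
  have upper: "\<sigma> (int (n - j)) \<le> int (n - j)" if "j \<le> n" for j
    using that
  proof (induction j)
    case 0
    have "\<sigma> (int n) \<in> pm_set n \<or> n = 0"
      using permutes_in_image[OF D(1), of "int n"] by (auto simp: mem_pm_set)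
    then show ?case by (auto simp: mem_pm_set D)
  next
    case (Suc j)
    then show ?case using less[of "n - Suc j"] by (simp add: Suc_diff_Suc of_nat_diff)
  qed
  have pos: "\<sigma> (int j) = int j" if "j \<le> n" for j
    using lower[OF that] upper[of "n - j"] that by simp
  show ?thesis
  proof
    fix a
    consider "\<bar>a\<bar> \<le> int n" "0 \<le> a" | "\<bar>a\<bar> \<le> int n" "a < 0" | "\<bar>a\<bar> > int n" by linarith
    then show "\<sigma> a = id a"
    proof cases
      case 1 then show ?thesis using pos[of "nat a"] by simp
    next
      case 2 then show ?thesis using pos[of "nat (- a)"] D(4)[of a] by simp
    next
      case 3 then show ?thesis using permutes_not_in[OF D(1), of a] by (simp add: mem_pm_set)
    qed
  qed
qed

lemma word_B_Nil [simp]: "word_B [] = id"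
  by (simp add: word_B_def)

lemma word_B_Cons: "word_B (i # is) = gen_B i \<circ> word_B is"
  by (simp add: word_B_def)

lemma word_B_snoc: "word_B (is @ [i]) = word_B is \<circ> gen_B i"
  by (induction "is") (simp_all add: word_B_Cons o_assoc)

lemma word_B_hyperoct: "set is \<subseteq> {0..<n} \<Longrightarrow> word_B is \<in> hyperoct n"
  by (induction "is") (auto simp: word_B_Cons hyperoct_id intro!: hyperoct_comp hyperoct_gen_B)

lemma len_window_id: "len (window n id) = 0"
  unfolding window_def by (rule len_pos_sorted) auto

lemma len_window_word_B_le: "set is \<subseteq> {0..<n} \<Longrightarrow> len (window n (word_B is)) \<le> length is"
proof (induction "is" rule: rev_induct)
  case (snoc i "is")
  then have "len (window n (word_B is \<circ> gen_B i)) \<le> Suc (len (window n (word_B is)))"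
    using len_comp_gen_B[OF word_B_hyperoct, of "is" n i] by (auto split: if_splits)
  also have "\<dots> \<le> length (is @ [i])" using snoc by simp
  finally show ?case unfolding word_B_snoc .
qed (simp add: len_window_id)

text \<open>Multiplying by a generator at a descent lowers \<open>len\<close> by one; only the
  identity has no descent.\<close>

lemma ex_word_B:
  assumes "\<sigma> \<in> hyperoct n"
  shows "\<exists>is. length is = len (window n \<sigma>) \<and> set is \<subseteq> {0..<n} \<and> \<sigma> = word_B is"
  using assms
proof (induction "len (window n \<sigma>)" arbitrary: \<sigma> rule: less_induct)
  case less
  show ?case
  proof (cases "\<exists>i<n. \<sigma> (int i) > \<sigma> (int i + 1)")
    case True
    then obtain i where i: "i < n" "\<sigma> (int i) > \<sigma> (int i + 1)" by blast
    then have l: "len (window n \<sigma>) = Suc (len (window n (\<sigma> \<circ> gen_B i)))"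
      using len_comp_gen_B[OF less.prems i(1)] by simp
    with less.hyps[of "\<sigma> \<circ> gen_B i"] hyperoct_comp[OF less.prems hyperoct_gen_B[OF i(1)]]
    obtain "is" where "is": "length is = len (window n (\<sigma> \<circ> gen_B i))" "set is \<subseteq> {0..<n}"
      "\<sigma> \<circ> gen_B i = word_B is" by auto
    have "\<sigma> = \<sigma> \<circ> gen_B i \<circ> gen_B i" by (simp add: gen_B_gen_B comp_assoc)
    also have "\<dots> = word_B (is @ [i])" by (simp only: "is"(3) word_B_snoc)
    finally show ?thesis using "is"(1,2) i(1) l by (intro exI[of _ "is @ [i]"]) auto
  next
    case False
    then have "\<sigma> = id" using hyperoct_eq_id[OF less.prems] by (meson not_less)
    then show ?thesis by (intro exI[of _ "[]"]) (simp add: len_window_id)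
  qed
qed

lemma length_B_eq_len:
  assumes "\<sigma> \<in> hyperoct n"
  shows "length_B n \<sigma> = len (window n \<sigma>)"
  unfolding length_B_def
  by (rule Least_equality) (use ex_word_B[OF assms] len_window_word_B_le in auto)

lemma inv_gen_B: "inv (gen_B i) = gen_B i"
  using gen_B_gen_B by (intro inv_unique_comp)

lemma inv_word_B: "set is \<subseteq> {0..<n} \<Longrightarrow> inv (word_B is) = word_B (rev is)"
proof (induction "is")
  case (Cons i "is")
  then have "bij (gen_B i)" "bij (word_B is)"
    using hyperoctD(2)[OF hyperoct_gen_B, of i n] hyperoctD(2)[OF word_B_hyperoct, of "is" n] by auto
  then have "inv (gen_B i \<circ> word_B is) = inv (word_B is) \<circ> inv (gen_B i)"
    by (rule o_inv_distrib)
  also have "inv (word_B is) = word_B (rev is)" using Cons by simp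
  finally show ?case unfolding rev.simps word_B_Cons word_B_snoc inv_gen_B .
qed (simp add: inv_id)

text \<open>Generators are involutions, so a reversed word represents the inverse.\<close>

lemma length_B_inv:
  assumes "\<sigma> \<in> hyperoct n"
  shows "length_B n (inv \<sigma>) = length_B n \<sigma>"
proof -
  have le: "length_B n (inv \<tau>) \<le> length_B n \<tau>" if \<tau>: "\<tau> \<in> hyperoct n" for \<tau>
  proof -
    obtain "is" where "is": "length is = len (window n \<tau>)" "set is \<subseteq> {0..<n}" "\<tau> = word_B is"
      using ex_word_B[OF \<tau>] by blast
    then have "len (window n (inv \<tau>)) \<le> length (rev is)"
      using inv_word_B[OF "is"(2)] len_window_word_B_le[of "rev is" n] by simp
    then show ?thesis using "is"(1) \<tau> by (simp add: length_B_eq_len hyperoct_inv)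
  qed
  show ?thesis
    using le[OF assms] le[OF hyperoct_inv[OF assms]] hyperoctD(2)[OF assms] by (simp add: inv_inv_eq)
qed

lemma Des_B_eq:
  assumes "\<sigma> \<in> hyperoct n"
  shows "Des_B n \<sigma> = {i. i < n \<and> dsc (0 # window n \<sigma>) ! i}"
proof -
  have nth: "(0 # window n \<sigma>) ! i = \<sigma> (int i)" if "i \<le> n" for i
    using that hyperoctD(3)[OF assms] by (cases i) (auto simp: window_def)
  have "length_B n (\<sigma> \<circ> gen_B i) < length_B n \<sigma> \<longleftrightarrow> dsc (0 # window n \<sigma>) ! i" if "i < n" for i
  proof -
    have "length_B n (\<sigma> \<circ> gen_B i) < length_B n \<sigma> \<longleftrightarrow> \<sigma> (int i) > \<sigma> (int i + 1)"
      using len_comp_gen_B[OF assms that] hyperoct_comp[OF assms hyperoct_gen_B[OF that]] assms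
      by (auto simp: length_B_eq_len split: if_splits)
    also have "\<dots> \<longleftrightarrow> dsc (0 # window n \<sigma>) ! i"
      using nth_dsc[of i "0 # window n \<sigma>"] nth[of i] nth[of "Suc i"] that
      by (simp add: window_def add.commute)
    finally show ?thesis .
  qed
  then show ?thesis by (auto simp: Des_B_def)
qed

section \<open>Signed words as windows of group elements\<close>

lemma window_in_signed_words:
  assumes "\<sigma> \<in> hyperoct n"
  shows "window n \<sigma> \<in> signed_words {1..int n}"
proof -
  note D = hyperoctD[OF assms]
  have abs_eq: "\<bar>\<sigma> a\<bar> = \<bar>\<sigma> b\<bar> \<longleftrightarrow> \<bar>a\<bar> = \<bar>b\<bar>" for a b
    using D(4,6) by (metis abs_eq_iff)
  have inj: "inj_on (\<lambda>a. \<bar>\<sigma> a\<bar>) {1..int n}"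
    by (rule inj_onI) (simp add: abs_eq)
  have "(\<lambda>a. \<bar>\<sigma> a\<bar>) ` {1..int n} = {1..int n}"
  proof (rule endo_inj_surj[OF _ _ inj])
    show "(\<lambda>a. \<bar>\<sigma> a\<bar>) ` {1..int n} \<subseteq> {1..int n}"
    proof clarify
      fix a assume "a \<in> {1..int n}"
      then have "\<sigma> a \<in> pm_set n"
        unfolding permutes_in_image[OF D(1)] by (simp add: mem_pm_set)
      then show "\<bar>\<sigma> a\<bar> \<in> {1..int n}" by (auto simp: mem_pm_set)
    qed
  qed simp
  moreover have "map abs (window n \<sigma>) = map (\<lambda>a. \<bar>\<sigma> a\<bar>) [1..int n]"
    by (simp add: window_def)
  ultimately show ?thesis
    using inj unfolding signed_words_def by (auto simp: distinct_map intro!: permutations_of_setI)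
qed

lemma window_bij: "bij_betw (window n) (hyperoct n) (signed_words {1..int n})"
proof (rule bij_betwI')
  fix \<sigma> \<tau> assume \<sigma>: "\<sigma> \<in> hyperoct n" and \<tau>: "\<tau> \<in> hyperoct n"
  show "window n \<sigma> = window n \<tau> \<longleftrightarrow> \<sigma> = \<tau>"
  proof
    assume "window n \<sigma> = window n \<tau>"
    then have *: "\<sigma> a = \<tau> a" if "a \<in> {1..int n}" for a using that by (auto simp: window_def)
    show "\<sigma> = \<tau>"
    proof
      fix a
      consider "a \<in> {1..int n}" | "- a \<in> {1..int n}" | "a \<notin> pm_set n" unfolding mem_pm_set atLeastAtMost_iff by linarith
      then show "\<sigma> a = \<tau> a"
      proof cases
        case 2
        then show ?thesis using *[of "- a"] hyperoctD(4)[OF \<sigma>, of a] hyperoctD(4)[OF \<tau>, of a] by simp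
      qed (use * permutes_not_in[OF hyperoctD(1)[OF \<sigma>]] permutes_not_in[OF hyperoctD(1)[OF \<tau>]] in auto)
    qed
  qed simp
next
  fix t assume t: "t \<in> signed_words {1..int n}"
  note D = signed_wordsD[OF t]
  have l: "length t = n" using D(3) by simp
  \<comment> \<open>The odd extension of \<open>t\<close>, with \<open>- 1\<close> since list
    indices start at \<open>0\<close>, and the identity outside \<open>pm_set n\<close>.\<close>
  define \<tau> where "\<tau> a = (if a \<in> pm_set n then sgn a * t ! (nat \<bar>a\<bar> - 1) else a)" for a
  have idx: "nat \<bar>a\<bar> - 1 < length t" if "a \<in> pm_set n" for a
    using that l by (auto simp: mem_pm_set)
  have val: "t ! (nat \<bar>a\<bar> - 1) \<in> pm_set n" if "a \<in> pm_set n" for a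
  proof -
    have "\<bar>t ! (nat \<bar>a\<bar> - 1)\<bar> \<in> {1..int n}"
      using D(2) nth_mem[OF idx[OF that]] by blast
    then show ?thesis by (auto simp: mem_pm_set)
  qed
  have sub: "\<tau> ` pm_set n \<subseteq> pm_set n"
  proof clarify
    fix a assume "a \<in> pm_set n"
    then show "\<tau> a \<in> pm_set n" using val[of a] by (auto simp: \<tau>_def mem_pm_set abs_mult sgn_if)
  qed
  have inj: "inj_on \<tau> (pm_set n)"
  proof (rule inj_onI)
    fix a b assume a: "a \<in> pm_set n" and b: "b \<in> pm_set n" and eq: "\<tau> a = \<tau> b"
    have "\<bar>\<tau> a\<bar> = \<bar>\<tau> b\<bar>" using eq by simp
    then have "map abs t ! (nat \<bar>a\<bar> - 1) = map abs t ! (nat \<bar>b\<bar> - 1)"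
      using a b idx by (auto simp: \<tau>_def abs_mult mem_pm_set abs_sgn_eq)
    then have "nat \<bar>a\<bar> - 1 = nat \<bar>b\<bar> - 1"
      using D(1) idx[OF a] idx[OF b] by (simp only: nth_eq_iff_index_eq length_map)
    moreover have "0 < nat \<bar>a\<bar>" "0 < nat \<bar>b\<bar>" using a b by (auto simp: mem_pm_set)
    ultimately have "nat \<bar>a\<bar> = nat \<bar>b\<bar>" by linarith
    then have ab: "\<bar>a\<bar> = \<bar>b\<bar>" by simp
    then have "sgn a = sgn b"
      using eq a b val[OF a] by (simp add: \<tau>_def mem_pm_set)
    then show "a = b" using ab by (metis mult_sgn_abs)
  qed
  have "bij_betw \<tau> (pm_set n) (pm_set n)"
    using endo_inj_surj[OF _ sub inj] inj by (simp add: bij_betw_def pm_set_def)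
  then have "\<tau> permutes pm_set n" by (rule bij_imp_permutes) (simp add: \<tau>_def)
  moreover have "\<tau> (- a) = - \<tau> a" for a by (simp add: \<tau>_def mem_pm_set)
  ultimately have "\<tau> \<in> hyperoct n" by (simp add: hyperoct_def)
  moreover have "t = window n \<tau>"
    by (rule nth_equalityI) (auto simp: l window_def \<tau>_def mem_pm_set nat_add_distrib)
  ultimately show "\<exists>\<tau>\<in>hyperoct n. t = window n \<tau>" by blast
qed (rule window_in_signed_words)

lemma bij_betw_inv_hyperoct: "bij_betw inv (hyperoct n) (hyperoct n)"
  by (rule bij_betw_byWitness[where f' = inv]) (auto simp: hyperoct_inv inv_inv_eq hyperoctD(2))

text \<open>By oddness, place \<open>\<bar>\<sigma> j\<bar>\<close> of the window of the inverse
  holds \<open>j\<close> with the sign of \<open>\<sigma> j\<close>.\<close>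

lemma pos_window_inv:
  assumes "\<sigma> \<in> hyperoct n" "j \<in> {1..int n}"
  shows "pos (window n (inv \<sigma>)) j = \<sigma> j"
proof -
  define \<tau> where "\<tau> = inv \<sigma>"
  have \<tau>: "\<tau> \<in> hyperoct n" unfolding \<tau>_def by (rule hyperoct_inv[OF assms(1)])
  define a where "a = \<bar>\<sigma> j\<bar>"
  have "\<sigma> j \<in> pm_set n"
    unfolding permutes_in_image[OF hyperoctD(1)[OF assms(1)]] using assms(2) by (simp add: mem_pm_set)
  then have a: "1 \<le> a" "a \<le> int n" and \<sigma>j: "\<sigma> j = sgn (\<sigma> j) * a"
    by (auto simp: mem_pm_set a_def sgn_mult_abs)
  have inv: "\<tau> (\<sigma> j) = j"
    unfolding \<tau>_def using hyperoctD(2)[OF assms(1)] by (simp add: bij_is_inj)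
  have x: "\<tau> a = sgn (\<sigma> j) * j"
    using inv hyperoctD(4)[OF \<tau>, of a] a \<sigma>j by (cases "0 < \<sigma> j") (auto simp: a_def abs_if split: if_splits)
  have "[1..int n] = [1..a - 1] @ [a..int n]"
    using a by (intro upto_split1) auto
  also have "[a..int n] = a # [a + 1..int n]" using a by (simp add: upto_rec1)
  finally have win: "window n \<tau> = map \<tau> [1..a - 1] @ \<tau> a # map \<tau> [a + 1..int n]"
    by (simp add: window_def)
  have "\<sigma> j \<noteq> 0" using a by (simp add: a_def)
  then have "\<tau> a \<noteq> 0" "\<bar>\<tau> a\<bar> = j" "sgn (\<tau> a) = sgn (\<sigma> j)"
    using x assms(2) by (auto simp: abs_mult sgn_mult sgn_0_0 abs_sgn_eq)
  moreover have "distinct (map abs (window n \<tau>))"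
    by (rule signed_wordsD(1)[OF window_in_signed_words[OF \<tau>]])
  ultimately have "pos (window n \<tau>) j = sgn (\<sigma> j) * a"
    using pos_split[of "map \<tau> [1..a - 1]" "\<tau> a" "map \<tau> [a + 1..int n]"] a by (simp add: win)
  then show ?thesis using \<sigma>j by (simp add: \<tau>_def)
qed

lemma fmaj_pos_window_inv:
  assumes "\<sigma> \<in> hyperoct n"
  shows "fmaj n (pos (window n (inv \<sigma>))) = fmaj n \<sigma>"
proof (rule fmaj_cong)
  fix i assume "i \<in> {1..n}"
  then show "pos (window n (inv \<sigma>)) (int i) < 0 \<longleftrightarrow> \<sigma> (int i) < 0"
    using pos_window_inv[OF assms, of "int i"] by simp
next
  fix i assume "i \<in> {1..<n}"
  then show "pos (window n (inv \<sigma>)) (int i) > pos (window n (inv \<sigma>)) (int i + 1) \<longleftrightarrow> \<sigma> (int i) > \<sigma> (int i + 1)"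
    using pos_window_inv[OF assms, of "int i"] pos_window_inv[OF assms, of "int i + 1"] by simp
qed

theorem theorem3p4:
  fixes n :: nat and M :: "nat set"
  assumes "n \<ge> 1" and "M \<subseteq> {0..n - 1}"
  shows "(\<Sum>\<sigma> | \<sigma> \<in> hyperoct n \<and> Des_B n (inv \<sigma>) = M. monom (1::int) (length_B n \<sigma>))
       = (\<Sum>\<sigma> | \<sigma> \<in> hyperoct n \<and> Des_B n (inv \<sigma>) = M. monom (1::int) (fmaj n \<sigma>))"
proof -
  define q :: "int poly" where "q = [:0, 1:]"
  \<comment> \<open>The indicator of the descent set \<open>M\<close> turns the restricted sums into
    sums over all signed words.\<close>
  define g :: "bool list \<Rightarrow> int \<Rightarrow> int poly" where "g d p = (if {i. i < n \<and> d ! i} = M then 1 else 0)" for d p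
  have bij: "bij_betw (\<lambda>\<sigma>. window n (inv \<sigma>)) (hyperoct n) (signed_words {1..int n})"
    using bij_betw_trans[OF bij_betw_inv_hyperoct window_bij] by (simp add: comp_def)
  \<comment> \<open>One transfer to words serves both statistics: \<open>f\<close> on the group
    corresponds to \<open>h\<close> on the window of the inverse.\<close>
  have sum: "(\<Sum>\<sigma> | \<sigma> \<in> hyperoct n \<and> Des_B n (inv \<sigma>) = M. monom (1::int) (f \<sigma>))
      = (\<Sum>t\<in>signed_words {1..int n}. q ^ h t * g (dsc (0 # t)) (pos t (int n)))"
    if "\<And>\<sigma>. \<sigma> \<in> hyperoct n \<Longrightarrow> f \<sigma> = h (window n (inv \<sigma>))" for f h
  proof -
    have "(\<Sum>\<sigma> | \<sigma> \<in> hyperoct n \<and> Des_B n (inv \<sigma>) = M. monom (1::int) (f \<sigma>))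
        = (\<Sum>\<sigma>\<in>hyperoct n. if Des_B n (inv \<sigma>) = M then monom (1::int) (f \<sigma>) else 0)"
      by (simp add: sum.inter_filter[symmetric] finite_hyperoct)
    also have "\<dots> = (\<Sum>\<sigma>\<in>hyperoct n. q ^ h (window n (inv \<sigma>)) * g (dsc (0 # window n (inv \<sigma>))) (pos (window n (inv \<sigma>)) (int n)))"
      by (intro sum.cong refl) (simp add: Des_B_eq hyperoct_inv that g_def q_def monom_altdef)
    also have "\<dots> = (\<Sum>t\<in>signed_words {1..int n}. q ^ h t * g (dsc (0 # t)) (pos t (int n)))"
      by (rule sum.reindex_bij_betw[OF bij])
    finally show ?thesis .
  qed
  have "length_B n \<sigma> = len (window n (inv \<sigma>))" if "\<sigma> \<in> hyperoct n" for \<sigma>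
    using length_B_inv[OF that] length_B_eq_len[OF hyperoct_inv[OF that]] by simp
  then show ?thesis
    using sum[of "length_B n" len] sum[of "fmaj n" "\<lambda>t. fmaj n (pos t)"]
      sum_fmaj_eq_sum_len[of q n g] fmaj_pos_window_inv by simp
qed

end
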